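(* For every $\boldsymbol{\mathit{ba}\ell}$-algebra $A$, the pair $(D(\mathbb R[B]),\alpha)$ is a canonical extension of $A$: $\alpha:A\to D(\mathbb R[B])$ is an injective $\boldsymbol{\mathit{ba}\ell}$-morphism that is dense and compact.
   Context: A $\boldsymbol{\mathit{ba}\ell}$-algebra is a commutative unital lattice-ordered algebra $A$ over $\mathbb R$ that is bounded (for every $a\in A$ there is an integer $n\ge1$ with $a\le n\cdot1$) and archimedean (if $na\le b$ for all $n\ge1$ then $a\le0$); reals $r$ are identified with $r\cdot1$; $\boldsymbol{\mathit{ba}\ell}$-morphisms are unital $\ell$-algebra homomorphisms. For $a\in A$: $a^+=a\vee0$, $a^-=(-a)\vee0$. An $\ell$-ideal is a ring ideal $I$ with $|a|\le|b|$, $b\in I\Rightarrow a\in I$; it is archimedean if $A/I$ is archimedean. ${\sf Arch}(A)$ is the set of archimedean $\ell$-ideals ordered by inclusion, a bounded distributive lattice (a frame) with meet $\cap$ and join $I\vee J$ the least archimedean $\ell$-ideal containing $I\cup J$. $B$ is the free boolean extension of the bounded distributive lattice ${\sf Arch}(A)$; ${\sf Arch}(A)\subseteq B$ and $\lnot$ is complement in $B$. For a boolean algebra $B$, $\mathbb R[B]$ is the quotient of $\mathbb R[x_e\mid e\in B]$ by the ideal generated by $x_{e\wedge f}-x_ex_f$, $x_{e\vee f}-(x_e+x_f-x_ex_f)$, $x_{\lnot e}-(1-x_e)$, $x_0$; it is a $\boldsymbol{\mathit{ba}\ell}$-algebra. $D(\mathbb R[B])$ is its Dedekind completion (Dedekind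 complete $\boldsymbol{\mathit{ba}\ell}$-algebra containing $\mathbb R[B]$, every element a join of elements of $\mathbb R[B]$). $\alpha(a)=-s+\bigvee\{rx_{\lnot I}\mid r\in\mathbb R,\ I\in{\sf Arch}(A),\ (a+s-r)^-\in I\}$ for any $s\in\mathbb R$ with $a+s\ge0$ (well defined, independent of $s$). For a $\boldsymbol{\mathit{ba}\ell}$-algebra $A$, a Dedekind complete $\boldsymbol{\mathit{ba}\ell}$-algebra $D$ and an injective $\boldsymbol{\mathit{ba}\ell}$-morphism $\zeta:A\to D$: $\zeta$ is compact if whenever $S,T\subseteq A$ and $\varepsilon>0$ with $\bigwedge\zeta[S]+\varepsilon\le\bigvee\zeta[T]$, there are finite $S_0\subseteq S$, $T_0\subseteq T$ with $\bigwedge S_0\le\bigvee T_0$; $\zeta$ is dense if each element of $D$ is a join of meets of elements of $\zeta[A]$; $(D,\zeta)$ is a canonical extension of $A$ if $\zeta$ is dense and compact. *)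

theory Defs
  imports Complex_Main "HOL-Library.Poly_Mapping"
begin

class ba_algebra = comm_ring_1 + real_algebra_1 + lattice +
  assumes bal_add_mono: "a \<le> b \<Longrightarrow> a + c \<le> b + c"
    and bal_mult_nonneg: "0 \<le> a \<Longrightarrow> 0 \<le> b \<Longrightarrow> 0 \<le> a * b"
    and bal_scale_nonneg: "0 \<le> r \<Longrightarrow> 0 \<le> a \<Longrightarrow> 0 \<le> r *\<^sub>R a"
    and bal_bounded: "\<exists>n::nat. n \<ge> 1 \<and> a \<le> of_nat n"
    and bal_archimedean: "(\<And>n::nat. n \<ge> 1 \<Longrightarrow> of_nat n * a \<le> b) \<Longrightarrow> a \<le> 0"

definition pospart :: "'a::ba_algebra \<Rightarrow> 'a" where
  "pospart a = sup a 0"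

definition negpart :: "'a::ba_algebra \<Rightarrow> 'a" where
  "negpart a = sup (- a) 0"

definition labs :: "'a::ba_algebra \<Rightarrow> 'a" where
  "labs a = sup a (- a)"

definition bal_hom :: "('a::ba_algebra \<Rightarrow> 'b::ba_algebra) \<Rightarrow> bool" where
  "bal_hom f \<longleftrightarrow>
     (\<forall>a b. f (a + b) = f a + f b) \<and>
     (\<forall>a b. f (a * b) = f a * f b) \<and>
     (\<forall>r a. f (r *\<^sub>R a) = r *\<^sub>R f a) \<and>
     f 1 = 1 \<and>
     (\<forall>a b. f (sup a b) = sup (f a) (f b)) \<and>
     (\<forall>a b. f (inf a b) = inf (f a) (f b))"

definition ring_ideal :: "'a::comm_ring_1 set \<Rightarrow> bool" where
  "ring_ideal I \<longleftrightarrow> 0 \<in> I \<and> (\<forall>a\<in>I. \<forall>b\<in>I. a + b \<in> I) \<and> (\<forall>a\<in>I. \<forall>c. c * a \<in> I)"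

definition l_ideal :: "'a::ba_algebra set \<Rightarrow> bool" where
  "l_ideal I \<longleftrightarrow> ring_ideal I \<and> (\<forall>a b. labs a \<le> labs b \<and> b \<in> I \<longrightarrow> a \<in> I)"

text \<open>Order of the quotient A/I: [a] \<le> [b] iff (a - b)^+ \<in> I.\<close>
definition quot_le :: "'a::ba_algebra set \<Rightarrow> 'a \<Rightarrow> 'a \<Rightarrow> bool" where
  "quot_le I a b \<longleftrightarrow> pospart (a - b) \<in> I"

definition arch_ideal :: "'a::ba_algebra set \<Rightarrow> bool" where
  "arch_ideal I \<longleftrightarrow> l_ideal I \<and>
     (\<forall>a b. (\<forall>n::nat. n \<ge> 1 \<longrightarrow> quot_le I (of_nat n * a) b) \<longrightarrow> quot_le I a 0)"

definition Arch :: "'a::ba_algebra set set" where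
  "Arch = {I. arch_ideal I}"

definition arch_join :: "'a::ba_algebra set \<Rightarrow> 'a set \<Rightarrow> 'a set" where
  "arch_join I J = \<Inter> {K \<in> Arch. I \<union> J \<subseteq> K}"

definition bool_generated :: "'b::boolean_algebra set \<Rightarrow> 'b set" where
  "bool_generated G = \<Inter> {C. G \<subseteq> C \<and> bot \<in> C \<and> top \<in> C \<and>
      (\<forall>x\<in>C. \<forall>y\<in>C. inf x y \<in> C \<and> sup x y \<in> C) \<and> (\<forall>x\<in>C. - x \<in> C)}"

text \<open>j embeds Arch(A) as a bounded sublattice of the boolean algebra 'b, and the image
generates 'b: i.e. ('b, j) is the free boolean extension of Arch(A).\<close>
definition free_bool_ext :: "('a::ba_algebra set \<Rightarrow> 'b::boolean_algebra) \<Rightarrow> bool" where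
  "free_bool_ext j \<longleftrightarrow>
     inj_on j Arch \<and>
     (\<forall>I\<in>Arch. \<forall>J\<in>Arch. j (I \<inter> J) = inf (j I) (j J)) \<and>
     (\<forall>I\<in>Arch. \<forall>J\<in>Arch. j (arch_join I J) = sup (j I) (j J)) \<and>
     j {0} = bot \<and> j UNIV = top \<and>
     bool_generated (j ` Arch) = UNIV"

type_synonym 'b rpoly = "('b \<Rightarrow>\<^sub>0 nat) \<Rightarrow>\<^sub>0 real"

definition pvar :: "'b \<Rightarrow> 'b rpoly" where
  "pvar e = Poly_Mapping.single (Poly_Mapping.single e 1) 1"

definition RB_gens :: "'b::boolean_algebra rpoly set" where
  "RB_gens =
     {pvar (inf e f) - pvar e * pvar f | e f. True} \<union>
     {pvar (sup e f) - (pvar e + pvar f - pvar e * pvar f) | e f. True} \<union>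
     {pvar (- e) - (1 - pvar e) | e. True} \<union>
     {pvar bot}"

definition RB_ideal :: "'b::boolean_algebra rpoly set" where
  "RB_ideal = \<Inter> {I. ring_ideal I \<and> RB_gens \<subseteq> I}"

definition monom_eval :: "('b \<Rightarrow> 'd::{comm_ring_1, real_algebra_1}) \<Rightarrow> ('b \<Rightarrow>\<^sub>0 nat) \<Rightarrow> 'd" where
  "monom_eval x m = (\<Prod>e\<in>Poly_Mapping.keys m. x e ^ Poly_Mapping.lookup m e)"

definition peval :: "('b \<Rightarrow> 'd::{comm_ring_1, real_algebra_1}) \<Rightarrow> 'b rpoly \<Rightarrow> 'd" where
  "peval x p = (\<Sum>m\<in>Poly_Mapping.keys p. Poly_Mapping.lookup p m *\<^sub>R monom_eval x m)"

text \<open>Points of the Stone space of B (boolean homomorphisms B \<rightarrow> 2).\<close>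
definition bool_point :: "('b::boolean_algebra \<Rightarrow> bool) \<Rightarrow> bool" where
  "bool_point h \<longleftrightarrow> (\<forall>e f. h (inf e f) = (h e \<and> h f)) \<and> (\<forall>e f. h (sup e f) = (h e \<or> h f))
      \<and> (\<forall>e. h (- e) = (\<not> h e)) \<and> \<not> h bot"

text \<open>The lattice order of R[B] (on representatives): pointwise on the Stone space.\<close>
definition RB_le :: "'b::boolean_algebra rpoly \<Rightarrow> 'b rpoly \<Rightarrow> bool" where
  "RB_le p q \<longleftrightarrow> (\<forall>h. bool_point h \<longrightarrow>
      peval (\<lambda>e. if h e then 1 else 0 :: real) p \<le> peval (\<lambda>e. if h e then 1 else 0 :: real) q)"

definition RB_is_sup :: "'b::boolean_algebra rpoly \<Rightarrow> 'b rpoly \<Rightarrow> 'b rpoly \<Rightarrow> bool" where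
  "RB_is_sup p q r \<longleftrightarrow> RB_le p r \<and> RB_le q r \<and> (\<forall>u. RB_le p u \<and> RB_le q u \<longrightarrow> RB_le r u)"

definition RB_is_inf :: "'b::boolean_algebra rpoly \<Rightarrow> 'b rpoly \<Rightarrow> 'b rpoly \<Rightarrow> bool" where
  "RB_is_inf p q r \<longleftrightarrow> RB_le r p \<and> RB_le r q \<and> (\<forall>u. RB_le u p \<and> RB_le u q \<longrightarrow> RB_le u r)"

definition is_join :: "'d::order set \<Rightarrow> 'd \<Rightarrow> bool" where
  "is_join S d \<longleftrightarrow> (\<forall>s\<in>S. s \<le> d) \<and> (\<forall>u. (\<forall>s\<in>S. s \<le> u) \<longrightarrow> d \<le> u)"

definition is_meet :: "'d::order set \<Rightarrow> 'd \<Rightarrow> bool" where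
  "is_meet S d \<longleftrightarrow> (\<forall>s\<in>S. d \<le> s) \<and> (\<forall>u. (\<forall>s\<in>S. u \<le> s) \<longrightarrow> u \<le> d)"

text \<open>D (a Dedekind complete baell-algebra) is a Dedekind completion of R[B], the embedding
R[B] \<rightarrow> D being the map induced by x_e \<mapsto> x e: it is a well defined unital algebra map on
the quotient, injective, a lattice homomorphism, and every element of D is a join of
elements of its image.\<close>
definition dedekind_completion_RB ::
  "('b::boolean_algebra \<Rightarrow> 'd::{ba_algebra, conditionally_complete_lattice}) \<Rightarrow> bool" where
  "dedekind_completion_RB x \<longleftrightarrow>
     (\<forall>g\<in>RB_gens. peval x g = 0) \<and>
     (\<forall>p. peval x p = 0 \<longrightarrow> p \<in> RB_ideal) \<and>
     (\<forall>p q r. RB_is_sup p q r \<longrightarrow> peval x r = sup (peval x p) (peval x q)) \<and>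
     (\<forall>p q r. RB_is_inf p q r \<longrightarrow> peval x r = inf (peval x p) (peval x q)) \<and>
     (\<forall>d. \<exists>S \<subseteq> range (peval x). is_join S d)"

definition alpha ::
  "('a::ba_algebra set \<Rightarrow> 'b::boolean_algebra) \<Rightarrow> ('b \<Rightarrow> 'd::{ba_algebra, conditionally_complete_lattice})
    \<Rightarrow> 'a \<Rightarrow> 'd" where
  "alpha j x a =
     (let s = (SOME s::real. 0 \<le> a + of_real s) in
       - of_real s + Sup {r *\<^sub>R x (- j I) | r I. I \<in> Arch \<and> negpart (a + of_real s - of_real r) \<in> I})"

definition dense_map :: "('a::ba_algebra \<Rightarrow> 'd::{ba_algebra, conditionally_complete_lattice}) \<Rightarrow> bool" where
  "dense_map \<zeta> \<longleftrightarrow> (\<forall>d. \<exists>M. is_join M d \<and> (\<forall>m\<in>M. \<exists>S \<subseteq> range \<zeta>. is_meet S m))"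

definition compact_map :: "('a::ba_algebra \<Rightarrow> 'd::{ba_algebra, conditionally_complete_lattice}) \<Rightarrow> bool" where
  "compact_map \<zeta> \<longleftrightarrow>
     (\<forall>S T (\<epsilon>::real) m k. S \<noteq> {} \<and> T \<noteq> {} \<and> \<epsilon> > 0 \<and>
        is_meet (\<zeta> ` S) m \<and> is_join (\<zeta> ` T) k \<and> m + of_real \<epsilon> \<le> k \<longrightarrow>
        (\<exists>S0 T0. finite S0 \<and> S0 \<noteq> {} \<and> S0 \<subseteq> S \<and> finite T0 \<and> T0 \<noteq> {} \<and> T0 \<subseteq> T \<and>
                 Inf_fin S0 \<le> Sup_fin T0))"

definition canonical_extension :: "('a::ba_algebra \<Rightarrow> 'd::{ba_algebra, conditionally_complete_lattice}) \<Rightarrow> bool" where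
  "canonical_extension \<zeta> \<longleftrightarrow> bal_hom \<zeta> \<and> inj \<zeta> \<and> dense_map \<zeta> \<and> compact_map \<zeta>"

end

theory Submission
  imports Defs "HOL-Library.Lattice_Algebras"
begin

text \<open>
  Call a unital \<open>\<ell>\<close>-algebra homomorphism from \<open>A\<close> to the reals a point. By Zorn's lemma the points
  separate the elements of \<open>A\<close>, and every archimedean \<open>\<ell>\<close>-ideal is an intersection of kernels of
  points (Yosida). Consequently the boolean algebra \<open>B\<close> is atomic, its atoms being the complements
  of the kernels of points. The atoms become idempotents \<open>y\<close> of the completion with
  \<open>D y = \<real> y\<close>, so every point \<open>\<phi>\<close> extends to an evaluation on \<open>D\<close>; these evaluations jointly
  reflect the order, turn \<open>D\<close> into an algebra of bounded functions on the set of points, and satisfy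
  \<open>\<alpha>(a)(\<phi>) = \<phi>(a)\<close>. All claims about \<open>\<alpha>\<close> are then checked pointwise, and compactness reduces to
  the fact that an \<open>\<ell>\<close>-ideal on which no point vanishes contains 1.
\<close>

section \<open>Lattice-ordered algebra\<close>

text \<open>The obstacle is that infinite joins and meets in \<open>D\<close> are given only by its
  order, and evaluation at an arbitrary point of the Stone space of \<open>B\<close> need not
  respect them. Evaluation at an atom does: with the idempotent of the atom, an element of
  \<open>D\<close> can be changed at that point alone, so a bound on values there becomes a bound in
  \<open>D\<close>. Hence atoms rather than Stone points are used. That atoms suffice rests on one
  computation. If \<open>1 \<le> m + n * u\<close> with \<open>m\<close> in an ideal,
  \<open>v \<ge> 0\<close> and \<open>u * v = 0\<close>, then multiplying by \<open>v\<close> gives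
  \<open>v \<le> v * m\<close>, so \<open>v\<close> is in the ideal. It makes maximal \<ell>-ideals
  prime, and applied to positive and negative parts it lets the archimedean property of an ideal
  produce points in its zero set.\<close>

instance ba_algebra \<subseteq> ordered_comm_ring
proof
  fix a b c :: 'a
  show add_mono: "c + a \<le> c + b" if "a \<le> b" for a b c :: 'a
    using bal_add_mono[OF that, of c] by (simp add: add.commute)
  assume "a \<le> b" "0 \<le> c"
  have "0 \<le> b - a"
    using bal_add_mono[OF \<open>a \<le> b\<close>, of "- a"] by simp
  from bal_mult_nonneg[OF \<open>0 \<le> c\<close> this] show "c * a \<le> c * b"
    using bal_add_mono[of 0 "c * (b - a)" "c * a"] by (simp add: algebra_simps)
qed

instance ba_algebra \<subseteq> lattice_ab_group_add ..

instance ba_algebra \<subseteq> ordered_real_vector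
proof
  fix a b :: real and u v :: 'a
  show "a *\<^sub>R u \<le> a *\<^sub>R v" if "u \<le> v" "0 \<le> a"
    using bal_scale_nonneg[of a "v - u"] that by (simp add: scaleR_diff_right)
  show "a *\<^sub>R u \<le> b *\<^sub>R u" if "a \<le> b" "0 \<le> u"
    using bal_scale_nonneg[of "b - a" u] that by (simp add: scaleR_diff_left)
qed

instance real :: ba_algebra
proof
  fix a b :: real
  show "\<exists>n::nat. n \<ge> 1 \<and> a \<le> of_nat n"
  proof -
    obtain n where "a \<le> real n" using real_arch_simple by blast
    then show ?thesis by (intro exI[of _ "max 1 n"]) auto
  qed
  show "a \<le> 0" if "\<And>n::nat. n \<ge> 1 \<Longrightarrow> of_nat n * a \<le> b"
  proof (rule ccontr)
    assume "\<not> a \<le> 0"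
    then obtain n where "b < real n * a" using reals_Archimedean3[of a] by auto
    moreover from \<open>\<not> a \<le> 0\<close> have "real n * a \<le> real (max 1 n) * a"
      by (intro mult_right_mono) auto
    ultimately show False using that[of "max 1 n"] by simp
  qed
qed auto

text \<open>Positivity of 1 is not an axiom: boundedness, applied to 0, makes some
  \<open>of_nat n\<close> with \<open>n \<ge> 1\<close> nonnegative, and it is scaled down to
  1.\<close>

lemma zero_le_one_bal: "(0::'a::ba_algebra) \<le> 1"
proof -
  obtain n :: nat where n: "n \<ge> 1" "(0::'a) \<le> of_nat n" using bal_bounded by blast
  have "(1 / real n) *\<^sub>R (of_nat n :: 'a) = (1 / real n * real n) *\<^sub>R 1"
    by (metis of_real_def of_real_of_nat_eq scaleR_scaleR)
  then show ?thesis using bal_scale_nonneg[of "1 / real n" "of_nat n :: 'a"] n by simp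
qed

lemma of_real_mono_bal: "r \<le> s \<Longrightarrow> (of_real r :: 'a::ba_algebra) \<le> of_real s"
  unfolding of_real_def by (rule scaleR_right_mono[OF _ zero_le_one_bal])

lemma of_real_nonneg_bal: "0 \<le> r \<Longrightarrow> (0 :: 'a::ba_algebra) \<le> of_real r"
  using of_real_mono_bal[of 0 r] by simp

lemma of_real_bound:
  obtains N :: real where "0 \<le> N" "a \<le> of_real N" "- of_real N \<le> (a::'a::ba_algebra)"
proof -
  obtain n :: nat where n: "a \<le> of_nat n" using bal_bounded by blast
  obtain m :: nat where m: "- a \<le> of_nat m" using bal_bounded by blast
  let ?N = "max (real n) (real m)"
  have "a \<le> of_real ?N"
    using n of_real_mono_bal[of "real n" ?N] order_trans by fastforce
  moreover have "- a \<le> of_real ?N"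
    using m of_real_mono_bal[of "real m" ?N] order_trans by fastforce
  then have "- of_real ?N \<le> a" using minus_le_iff by blast
  ultimately show ?thesis using that[of ?N] by simp
qed

text \<open>Errors of size \<open>1 / n\<close> bound every multiple
  \<open>of_nat n * (a - b)\<close> by 1, so the archimedean axiom applies.\<close>

lemma le_epsilon_bal:
  fixes a b :: "'a::ba_algebra"
  assumes "\<And>\<epsilon>. 0 < \<epsilon> \<Longrightarrow> a \<le> b + of_real \<epsilon>"
  shows "a \<le> b"
proof -
  have "a - b \<le> 0"
  proof (rule bal_archimedean)
    fix n :: nat assume n: "n \<ge> 1"
    then have "a - b \<le> of_real (1 / real n)"
      using assms[of "1 / real n"] by (simp add: algebra_simps)
    then have "real n *\<^sub>R (a - b) \<le> real n *\<^sub>R of_real (1 / real n)"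
      by (rule scaleR_left_mono) simp
    moreover have "real n *\<^sub>R (of_real (1 / real n) :: 'a) = 1"
      using n by (simp add: of_real_def)
    ultimately show "of_nat n * (a - b) \<le> 1"
      by (simp add: scaleR_conv_of_real)
  qed
  then show ?thesis by simp
qed

lemma scaleR_cancel_bal:
  fixes a b :: "'a::ba_algebra"
  assumes "r > 0" "r *\<^sub>R a \<le> r *\<^sub>R b" shows "a \<le> b"
  using scaleR_left_mono[OF assms(2), of "1 / r"] assms(1) by simp

lemma scaleR_inf_bal:
  fixes a b :: "'a::ba_algebra"
  assumes "r > 0" shows "r *\<^sub>R inf a b = inf (r *\<^sub>R a) (r *\<^sub>R b)"
proof (rule antisym)
  show "r *\<^sub>R inf a b \<le> inf (r *\<^sub>R a) (r *\<^sub>R b)"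
    using assms by (auto intro: scaleR_left_mono)
  have "(1/r) *\<^sub>R inf (r *\<^sub>R a) (r *\<^sub>R b) \<le> inf a b"
  proof (rule inf_greatest)
    show "(1/r) *\<^sub>R inf (r *\<^sub>R a) (r *\<^sub>R b) \<le> a"
      using scaleR_left_mono[of "inf (r *\<^sub>R a) (r *\<^sub>R b)" "r *\<^sub>R a" "1/r"] assms by simp
    show "(1/r) *\<^sub>R inf (r *\<^sub>R a) (r *\<^sub>R b) \<le> b"
      using scaleR_left_mono[of "inf (r *\<^sub>R a) (r *\<^sub>R b)" "r *\<^sub>R b" "1/r"] assms by simp
  qed
  from scaleR_left_mono[OF this, of r] assms
  show "inf (r *\<^sub>R a) (r *\<^sub>R b) \<le> r *\<^sub>R inf a b" by simp
qed

text \<open>By boundedness both factors lie below one constant \<open>L\<close>, so the product lies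
  below \<open>L\<close> times either factor, hence below
  \<open>L *\<^sub>R inf a b\<close>.\<close>

lemma disjoint_mult_eq_0:
  fixes a b :: "'a::ba_algebra"
  assumes "0 \<le> a" "0 \<le> b" "inf a b = 0"
  shows "a * b = 0"
proof (rule antisym)
  obtain N where N: "0 \<le> N" "a \<le> of_real N" by (rule of_real_bound)
  obtain K where K: "0 \<le> K" "b \<le> of_real K" by (rule of_real_bound)
  \<comment> \<open>The summand 1 keeps \<open>L\<close> positive, as pulling it out of
    \<open>inf\<close> requires.\<close>
  define L where "L = N + K + 1"
  have "a \<le> of_real L" "b \<le> of_real L"
    using N K order_trans[OF N(2) of_real_mono_bal[of N L]] order_trans[OF K(2) of_real_mono_bal[of K L]]
    by (simp_all add: L_def del: of_real_add)
  then have "a * b \<le> L *\<^sub>R b" "a * b \<le> L *\<^sub>R a"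
    using mult_right_mono[of a "of_real L" b] mult_left_mono[of b "of_real L" a] assms
    by (auto simp: scaleR_conv_of_real mult.commute)
  then have "a * b \<le> inf (L *\<^sub>R a) (L *\<^sub>R b)" by simp
  also have "\<dots> = L *\<^sub>R inf a b" using N K by (intro scaleR_inf_bal[symmetric]) (simp add: L_def)
  finally show "a * b \<le> 0" using assms by simp
qed (use assms in simp)

section \<open>Positive parts, negative parts and absolute values\<close>

lemma pospart_nonneg [simp]: "0 \<le> pospart a" and negpart_nonneg [simp]: "0 \<le> negpart a"
  by (simp_all add: pospart_def negpart_def)

lemma pospart_diff_negpart: "pospart a - negpart a = a"
  using prts[of a] pprt_neg[of a] by (simp add: pprt_def pospart_def negpart_def)

lemma pospart_uminus: "pospart (- a) = negpart a"
  by (simp add: pospart_def negpart_def)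

lemma pospart_mult_negpart: "pospart a * negpart a = 0"
proof (rule disjoint_mult_eq_0)
  have "inf (pospart a) (negpart a) = inf (pospart a - negpart a) 0 + negpart a"
    by (simp add: add_inf_distrib_right)
  also have "\<dots> = 0"
    unfolding pospart_diff_negpart
    using pprt_neg[of a, unfolded pprt_def nprt_def] by (simp only: negpart_def add.right_inverse)
  finally show "inf (pospart a) (negpart a) = 0" .
qed simp_all

lemma square_nonneg_bal: "0 \<le> a * (a::'a::ba_algebra)"
proof -
  have "a * a = pospart a * pospart a + negpart a * negpart a - 2 * (pospart a * negpart a)"
    by (subst (1 2) pospart_diff_negpart[of a, symmetric]) (simp add: algebra_simps)
  then show ?thesis by (simp add: pospart_mult_negpart)
qed

lemma idempotent_bounds:
  fixes y :: "'a::ba_algebra"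
  assumes "y * y = y" shows "0 \<le> y" "y \<le> 1"
proof -
  show "0 \<le> y" using square_nonneg_bal[of y] assms by simp
  have "0 \<le> 1 - y" using square_nonneg_bal[of "1 - y"] assms by (simp add: algebra_simps)
  then show "y \<le> 1" by simp
qed

lemma labs_ge: "a \<le> labs a" "- a \<le> labs a"
  by (simp_all add: labs_def)

lemma labs_le_iff: "labs a \<le> b \<longleftrightarrow> a \<le> b \<and> - a \<le> b"
  by (simp add: labs_def)

lemma labs_nonneg [simp]: "0 \<le> labs a"
proof -
  have "a + - a \<le> labs a + labs a" by (intro add_mono labs_ge)
  then have "0 \<le> 2 *\<^sub>R labs a" by (simp add: scaleR_2)
  then show ?thesis using scaleR_cancel_bal[of 2 0 "labs a"] by simp
qed

lemma labs_of_nonneg: "0 \<le> a \<Longrightarrow> labs a = a"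
  by (intro antisym) (auto simp: labs_le_iff labs_ge minus_le_self_iff)

lemma labs_uminus [simp]: "labs (- a) = labs a"
  by (simp add: labs_def sup_commute)

lemma labs_add_le: "labs (a + b) \<le> labs a + labs b"
  unfolding labs_le_iff minus_add_distrib by (intro conjI add_mono labs_ge)

lemma labs_mult_le: "labs (a * b) \<le> labs a * labs b"
proof -
  have aux: "c * d \<le> labs c * labs d" for c d :: 'a
  proof -
    have "0 \<le> labs c - c" "0 \<le> labs c + c" "0 \<le> labs d - d" "0 \<le> labs d + d"
      using labs_ge[of c] labs_ge[of d] diff_ge_0_iff_ge[of "labs c" "- c"]
        diff_ge_0_iff_ge[of "labs d" "- d"] by (simp_all del: diff_ge_0_iff_ge add: diff_ge_0_iff_ge[of _ c] diff_ge_0_iff_ge[of _ d])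
    \<comment> \<open>The mixed terms cancel, leaving twice the wanted difference.\<close>
    then have "0 \<le> (labs c - c) * (labs d + d) + (labs c + c) * (labs d - d)"
      by (metis add_nonneg_nonneg mult_nonneg_nonneg)
    also have "\<dots> = 2 *\<^sub>R (labs c * labs d - c * d)"
      by (simp add: algebra_simps scaleR_2)
    finally show ?thesis using scaleR_cancel_bal[of 2 0 "labs c * labs d - c * d"] by simp
  qed
  show ?thesis using aux[of a b] aux[of "- a" b] by (simp add: labs_le_iff)
qed

section \<open>Ideals and real points\<close>

lemma l_ideal_zero: "l_ideal I \<Longrightarrow> 0 \<in> I"
  by (simp add: l_ideal_def ring_ideal_def)

lemma l_ideal_add: "l_ideal I \<Longrightarrow> a \<in> I \<Longrightarrow> b \<in> I \<Longrightarrow> a + b \<in> I"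
  by (simp add: l_ideal_def ring_ideal_def)

lemma l_ideal_mult: "l_ideal I \<Longrightarrow> a \<in> I \<Longrightarrow> c * a \<in> I"
  by (simp add: l_ideal_def ring_ideal_def)

lemma l_ideal_uminus: "l_ideal I \<Longrightarrow> a \<in> I \<Longrightarrow> - a \<in> I"
  using l_ideal_mult[of I a "-1"] by simp

lemma l_ideal_diff: "l_ideal I \<Longrightarrow> a \<in> I \<Longrightarrow> b \<in> I \<Longrightarrow> a - b \<in> I"
  using l_ideal_add[of I a "- b"] l_ideal_uminus[of I b] by simp

lemma l_ideal_le: "l_ideal I \<Longrightarrow> b \<in> I \<Longrightarrow> labs a \<le> b \<Longrightarrow> a \<in> I"
  by (meson l_ideal_def labs_ge(1) order_trans)

lemma l_ideal_labs: "l_ideal I \<Longrightarrow> a \<in> I \<Longrightarrow> labs a \<in> I"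
  by (metis l_ideal_def labs_of_nonneg labs_nonneg order_refl)

lemma l_ideal_scaleR: "l_ideal I \<Longrightarrow> a \<in> I \<Longrightarrow> r *\<^sub>R a \<in> I"
  using l_ideal_mult[of I a "of_real r"] by (simp add: scaleR_conv_of_real)

lemma l_ideal_of_real: "l_ideal I \<Longrightarrow> of_real r \<in> I \<Longrightarrow> r \<noteq> 0 \<Longrightarrow> I = UNIV"
proof -
  assume I: "l_ideal I" "of_real r \<in> I" "r \<noteq> 0"
  from l_ideal_scaleR[OF this(1,2), of "1 / r"] this(3) have "1 \<in> I" by (simp add: of_real_def)
  then show "I = UNIV" using l_ideal_mult[OF I(1), of 1] by auto
qed

lemma l_ideal_sum: "l_ideal I \<Longrightarrow> (\<And>p. p \<in> F \<Longrightarrow> f p \<in> I) \<Longrightarrow> sum f F \<in> I"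
  by (induction F rule: infinite_finite_induct) (auto intro: l_ideal_zero l_ideal_add)

text \<open>Natural multiples can replace ring multiples because every ring element is dominated by
  an integer. The finite set records which generators are involved, as compactness needs.\<close>

definition l_ideal_gen :: "'a::ba_algebra set \<Rightarrow> 'a set" where
  "l_ideal_gen P = {a. \<exists>F (n::nat). finite F \<and> F \<subseteq> P \<and> labs a \<le> of_nat n * (\<Sum>p\<in>F. labs p)}"

lemma of_nat_nonneg_bal [simp]: "(0::'a::ba_algebra) \<le> of_nat n"
  using of_real_nonneg_bal[of "real n"] by simp

lemma l_ideal_gen_superset: "P \<subseteq> l_ideal_gen P"
proof
  fix p assume "p \<in> P"
  then show "p \<in> l_ideal_gen P"
    unfolding l_ideal_gen_def by (intro CollectI exI[of _ "{p}"] exI[of _ 1]) auto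
qed

lemma l_ideal_l_ideal_gen: "l_ideal (l_ideal_gen P)"
  unfolding l_ideal_def ring_ideal_def
proof (intro conjI ballI allI impI)
  show "0 \<in> l_ideal_gen P"
    unfolding l_ideal_gen_def by (intro CollectI exI[of _ "{}"]) (simp add: labs_of_nonneg)
next
  fix a b assume "a \<in> l_ideal_gen P" "b \<in> l_ideal_gen P"
  then obtain F G and n m :: nat where F: "finite F" "F \<subseteq> P" "labs a \<le> of_nat n * (\<Sum>p\<in>F. labs p)"
    and G: "finite G" "G \<subseteq> P" "labs b \<le> of_nat m * (\<Sum>p\<in>G. labs p)"
    unfolding l_ideal_gen_def by blast
  have "(\<Sum>p\<in>F. labs p) \<le> (\<Sum>p\<in>F \<union> G. labs p)" "(\<Sum>p\<in>G. labs p) \<le> (\<Sum>p\<in>F \<union> G. labs p)"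
    using F G by (auto intro!: sum_mono2)
  then have "labs a \<le> of_nat n * (\<Sum>p\<in>F \<union> G. labs p)" "labs b \<le> of_nat m * (\<Sum>p\<in>F \<union> G. labs p)"
    using F(3) G(3) by (meson mult_left_mono of_nat_nonneg_bal order_trans)+
  then have "labs (a + b) \<le> of_nat (n + m) * (\<Sum>p\<in>F \<union> G. labs p)"
    using order_trans[OF labs_add_le add_mono] by (simp add: distrib_right)
  then show "a + b \<in> l_ideal_gen P"
    unfolding l_ideal_gen_def using F G by (intro CollectI exI[of _ "F \<union> G"] exI[of _ "n + m"]) auto
next
  fix a c :: 'a assume "a \<in> l_ideal_gen P"
  then obtain F and n :: nat where F: "finite F" "F \<subseteq> P" "labs a \<le> of_nat n * (\<Sum>p\<in>F. labs p)"
    unfolding l_ideal_gen_def by blast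
  obtain k :: nat where "labs c \<le> of_nat k" using bal_bounded by blast
  then have "labs c * labs a \<le> of_nat k * (of_nat n * (\<Sum>p\<in>F. labs p))"
    using F by (intro mult_mono) auto
  then have "labs (c * a) \<le> of_nat (k * n) * (\<Sum>p\<in>F. labs p)"
    using order_trans[OF labs_mult_le] by (simp add: mult.assoc)
  then show "c * a \<in> l_ideal_gen P" unfolding l_ideal_gen_def using F by blast
next
  fix a b assume "labs a \<le> labs b \<and> b \<in> l_ideal_gen P"
  then show "a \<in> l_ideal_gen P" unfolding l_ideal_gen_def using order_trans by blast
qed

section \<open>Maximal \<ell>-ideals and the points they define\<close>

lemma maximal_l_ideal_exists:
  assumes "l_ideal I" "1 \<notin> I"
  obtains M :: "'a::ba_algebra set" where "l_ideal M" "1 \<notin> M" "I \<subseteq> M"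
    "\<And>N. l_ideal N \<Longrightarrow> M \<subseteq> N \<Longrightarrow> 1 \<notin> N \<Longrightarrow> N = M"
proof -
  let ?A = "{M. l_ideal M \<and> 1 \<notin> M \<and> I \<subseteq> M}"
  have "\<exists>M\<in>?A. \<forall>X\<in>?A. M \<subseteq> X \<longrightarrow> X = M"
  proof (rule subset_Zorn_nonempty)
    show "?A \<noteq> {}" using assms by blast
    fix C assume C: "C \<noteq> {}" "subset.chain ?A C"
    then have C': "\<And>M. M \<in> C \<Longrightarrow> l_ideal M \<and> 1 \<notin> M \<and> I \<subseteq> M"
      and lin: "\<And>M N. M \<in> C \<Longrightarrow> N \<in> C \<Longrightarrow> M \<subseteq> N \<or> N \<subseteq> M"
      by (auto simp: subset_chain_def)
    have "l_ideal (\<Union>C)"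
      unfolding l_ideal_def ring_ideal_def
    proof (intro conjI ballI allI impI)
      obtain K where K: "K \<in> C" using C(1) by blast
      then show "0 \<in> \<Union>C" using C'[OF K] l_ideal_zero by blast
    next
      fix a b assume "a \<in> \<Union>C" "b \<in> \<Union>C"
      then obtain K L where "K \<in> C" "a \<in> K" "L \<in> C" "b \<in> L" by blast
      then obtain N where "N \<in> C" "a \<in> N" "b \<in> N" using lin[of K L] by blast
      then show "a + b \<in> \<Union>C" using C'[of N] l_ideal_add[of N a b] by blast
    next
      fix a c :: 'a assume "a \<in> \<Union>C"
      then obtain K where "K \<in> C" "a \<in> K" by blast
      then show "c * a \<in> \<Union>C" using C'[of K] l_ideal_mult[of K a c] by blast
    next
      fix a b :: 'a assume "labs a \<le> labs b \<and> b \<in> \<Union>C"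
      then obtain K where "K \<in> C" "b \<in> K" "labs a \<le> labs b" by blast
      moreover from this have "a \<in> K" using C'[of K] unfolding l_ideal_def by blast
      ultimately show "a \<in> \<Union>C" by blast
    qed
    then show "\<Union>C \<in> ?A" using C(1) C' by blast
  qed
  then obtain M where M: "l_ideal M" "1 \<notin> M" "I \<subseteq> M"
    and max: "\<And>N. N \<in> ?A \<Longrightarrow> M \<subseteq> N \<Longrightarrow> N = M" by auto
  from M show ?thesis
  proof (rule that)
    show "N = M" if "l_ideal N" "M \<subseteq> N" "1 \<notin> N" for N
      using that M(3) by (intro max) auto
  qed
qed

text \<open>Positive and negative part have product 0 and the reals have no zero divisors, so one of
  the two images vanishes. Thus a positive ring homomorphism to the reals respects the lattice
  operations.\<close>

lemma positive_hom_pospart: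
  fixes f :: "'a::ba_algebra \<Rightarrow> real"
  assumes add: "\<And>a b. f (a + b) = f a + f b" and mult: "\<And>a b. f (a * b) = f a * f b"
    and pos: "\<And>a. 0 \<le> a \<Longrightarrow> 0 \<le> f a"
  shows "f (pospart a) = max (f a) 0"
proof -
  have "f (pospart a - negpart a) + f (negpart a) = f (pospart a)"
    using add[of "pospart a - negpart a" "negpart a"] by simp
  then have "f a = f (pospart a) - f (negpart a)" by (simp add: pospart_diff_negpart)
  moreover have "f 0 = 0" using add[of 0 0] by simp
  then have "f (pospart a) * f (negpart a) = 0" by (metis mult pospart_mult_negpart)
  moreover have "0 \<le> f (pospart a)" "0 \<le> f (negpart a)" by (auto intro: pos)
  ultimately show ?thesis by auto
qed

lemma sup_eq_pospart: "sup a b = pospart (a - b) + b"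
  by (simp add: pospart_def add_sup_distrib_right)

lemma inf_eq_pospart: "inf a b = a - pospart (a - b)"
proof -
  have "a + b = pospart (a - b) + b + inf a b"
    unfolding sup_eq_pospart[symmetric] by (rule add_eq_inf_sup)
  then show ?thesis by (simp add: eq_diff_eq add.commute add.left_commute)
qed

lemma positive_hom_bal_hom:
  fixes f :: "'a::ba_algebra \<Rightarrow> real"
  assumes add: "\<And>a b. f (a + b) = f a + f b" and mult: "\<And>a b. f (a * b) = f a * f b"
    and scale: "\<And>r a. f (r *\<^sub>R a) = r * f a" and one: "f 1 = 1"
    and pos: "\<And>a. 0 \<le> a \<Longrightarrow> 0 \<le> f a"
  shows "bal_hom f"
proof -
  have diff: "f (a - b) = f a - f b" for a b using add[of "a - b" b] by simp
  have pospart: "f (pospart a) = max (f a) 0" for a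
    using add mult pos by (rule positive_hom_pospart)
  have "f (sup a b) = sup (f a) (f b)" for a b
    unfolding sup_eq_pospart[of a b] add pospart diff by (simp add: sup_real_def max_def)
  moreover have "f (inf a b) = inf (f a) (f b)" for a b
    unfolding inf_eq_pospart[of a b] diff pospart by (simp add: inf_real_def min_def max_def)
  ultimately show ?thesis
    unfolding bal_hom_def using add mult scale one by simp
qed

lemma l_ideal_point:
  assumes M: "l_ideal M" "1 \<notin> M"
    and ex: "\<And>a. \<exists>r. a - of_real r \<in> M"
  obtains \<phi> :: "'a::ba_algebra \<Rightarrow> real" where "bal_hom \<phi>" "\<And>a. \<phi> a = 0 \<longleftrightarrow> a \<in> M"
proof -
  have uniq: "r = s" if "a - of_real r \<in> M" "a - of_real s \<in> M" for a r s
  proof (rule ccontr)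
    assume "r \<noteq> s"
    have "of_real (s - r) \<in> M"
      using l_ideal_diff[OF M(1) that] by simp
    then have "M = UNIV" using l_ideal_of_real[OF M(1), of "s - r"] \<open>r \<noteq> s\<close> by simp
    with M(2) show False by simp
  qed
  define \<phi> where "\<phi> a = (THE r. a - of_real r \<in> M)" for a
  have phiI: "\<phi> a = r" if "a - of_real r \<in> M" for a r
    unfolding \<phi>_def using that uniq by blast
  have phi: "a - of_real (\<phi> a) \<in> M" for a
    using ex[of a] phiI by blast
  have "bal_hom \<phi>"
  proof (rule positive_hom_bal_hom)
    fix a b :: 'a and r :: real
    show "\<phi> (a + b) = \<phi> a + \<phi> b"
      by (rule phiI) (use l_ideal_add[OF M(1) phi[of a] phi[of b]] in \<open>simp add: algebra_simps\<close>)
    show "\<phi> (a * b) = \<phi> a * \<phi> b"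
      by (rule phiI) (use l_ideal_add[OF M(1) l_ideal_mult[OF M(1) phi[of a], of b]
            l_ideal_mult[OF M(1) phi[of b], of "of_real (\<phi> a)"]] in \<open>simp add: algebra_simps\<close>)
    show "\<phi> (r *\<^sub>R a) = r * \<phi> a"
      by (rule phiI) (use l_ideal_mult[OF M(1) phi[of a], of "of_real r"] in
          \<open>simp add: algebra_simps scaleR_conv_of_real\<close>)
    show "\<phi> 1 = 1" by (rule phiI) (simp add: l_ideal_zero M)
    show "0 \<le> \<phi> a" if "0 \<le> a"
    proof (rule ccontr)
      assume neg: "\<not> 0 \<le> \<phi> a"
      \<comment> \<open>The element \<open>a - of_real (\<phi> a)\<close> of \<open>M\<close> would
        dominate a positive constant, making \<open>M\<close> everything.\<close>
      have "labs (of_real (- \<phi> a)) = (of_real (- \<phi> a) :: 'a)"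
        using neg by (intro labs_of_nonneg of_real_nonneg_bal) simp
      also have "\<dots> \<le> labs (a - of_real (\<phi> a))"
        using that labs_ge(1)[of "a - of_real (\<phi> a)"] order_trans[rotated] by fastforce
      finally have "of_real (- \<phi> a) \<in> M" using M(1) phi[of a] unfolding l_ideal_def by blast
      then have "M = UNIV" using l_ideal_of_real[OF M(1), of "- \<phi> a"] neg by simp
      with M(2) show False by simp
    qed
  qed
  moreover have "\<phi> a = 0 \<longleftrightarrow> a \<in> M" for a using phi[of a] phiI[of a 0] by auto
  ultimately show ?thesis using that by blast
qed

text \<open>Puts membership of 1 in the ideal generated by \<open>M\<close> and \<open>u\<close>
  into a form that can be multiplied by an element orthogonal to \<open>u\<close>.\<close>

lemma l_ideal_adjoin_split:
  assumes M: "l_ideal M" and F: "finite F" "F \<subseteq> insert u M" "1 \<le> of_nat n * (\<Sum>p\<in>F. labs p)"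
  obtains m where "m \<in> M" "0 \<le> m" "1 \<le> m + of_nat n * labs u"
proof
  let ?m = "of_nat n * (\<Sum>p\<in>F - {u}. labs p)"
  have "(\<Sum>p\<in>F. labs p) \<le> (\<Sum>p\<in>insert u F. labs p)"
    using F(1) by (intro sum_mono2) auto
  also have "\<dots> = labs u + (\<Sum>p\<in>F - {u}. labs p)" using F(1) by (simp add: sum.insert_remove)
  finally have "of_nat n * (\<Sum>p\<in>F. labs p) \<le> of_nat n * (labs u + (\<Sum>p\<in>F - {u}. labs p))"
    by (rule mult_left_mono) simp
  with F(3) have "1 \<le> of_nat n * (labs u + (\<Sum>p\<in>F - {u}. labs p))" by (rule order_trans)
  then show "1 \<le> ?m + of_nat n * labs u" by (simp add: distrib_left add.commute)
  show "?m \<in> M"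
    using F(2) by (intro l_ideal_mult l_ideal_sum l_ideal_labs M) auto
  show "0 \<le> ?m" by (intro mult_nonneg_nonneg sum_nonneg) auto
qed

lemma maximal_l_ideal_adjoin:
  assumes M: "l_ideal M" and max: "\<And>N. l_ideal N \<Longrightarrow> M \<subseteq> N \<Longrightarrow> 1 \<notin> N \<Longrightarrow> N = M"
    and u: "u \<notin> M"
  obtains m and n :: nat where "m \<in> M" "0 \<le> m" "1 \<le> m + of_nat n * labs u"
proof -
  let ?N = "l_ideal_gen (insert u M)"
  have "1 \<in> ?N"
    using max[OF l_ideal_l_ideal_gen, of "insert u M"] l_ideal_gen_superset[of "insert u M"] u by blast
  then obtain F and n :: nat where F: "finite F" "F \<subseteq> insert u M" "labs 1 \<le> of_nat n * (\<Sum>p\<in>F. labs p)"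
    unfolding l_ideal_gen_def by blast
  have "1 \<le> of_nat n * (\<Sum>p\<in>F. labs p)"
    using labs_ge(1) F(3) by (rule order_trans)
  with M F(1,2) show ?thesis using that by (rule l_ideal_adjoin_split)
qed

text \<open>Modulo \<open>M\<close> the order is total, by \<open>prime\<close>, and there are no
  infinitesimals, since maximality lifts a multiple of any element outside \<open>M\<close> above 1.
  So the real attached to \<open>a\<close> is the supremum of its lower cut
  \<open>L\<close>.\<close>

lemma maximal_l_ideal_real_quotient:
  fixes a :: "'a::ba_algebra"
  assumes M: "l_ideal M" "1 \<notin> M" and max: "\<And>N. l_ideal N \<Longrightarrow> M \<subseteq> N \<Longrightarrow> 1 \<notin> N \<Longrightarrow> N = M"
  shows "\<exists>r. a - of_real r \<in> M"
proof -
  have prime: "v \<in> M" if "u * v = 0" "0 \<le> u" "0 \<le> v" "u \<notin> M" for u v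
  proof -
    obtain m and n :: nat where m: "m \<in> M" "0 \<le> m" "1 \<le> m + of_nat n * labs u"
      using maximal_l_ideal_adjoin[OF M(1) max \<open>u \<notin> M\<close>] by blast
    have "v * 1 \<le> v * (m + of_nat n * u)"
      using m(3) that by (intro mult_left_mono) (auto simp: labs_of_nonneg)
    also have "\<dots> = v * m + of_nat n * (u * v)" by (simp add: algebra_simps)
    also have "\<dots> = v * m" using that by simp
    finally have "labs v \<le> v * m" using that by (simp add: labs_of_nonneg)
    then show "v \<in> M" using l_ideal_le[OF M(1) l_ideal_mult[OF M(1) m(1)]] by blast
  qed
  have unit: "of_real \<epsilon> \<le> m \<Longrightarrow> m \<in> M \<Longrightarrow> \<epsilon> > 0 \<Longrightarrow> False" for m \<epsilon>
    using l_ideal_le[OF M(1), of m "of_real \<epsilon>"] l_ideal_of_real[OF M(1), of \<epsilon>] M(2)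
      labs_of_nonneg[OF of_real_nonneg_bal[of \<epsilon>, where 'a='a]] by auto
  define L where "L = {r. negpart (a - of_real r) \<in> M}"
  obtain N where N: "0 \<le> N" "a \<le> of_real N" "- of_real N \<le> a" by (rule of_real_bound)
  have "- N \<in> L"
    using N l_ideal_zero[OF M(1)] unfolding L_def negpart_def by (simp add: sup_absorb2 add.commute minus_le_iff)
  have "r \<le> N" if "r \<in> L" for r
  proof (rule ccontr)
    assume "\<not> r \<le> N"
    have "of_real (r - N) \<le> negpart (a - of_real r)"
      using N(2) unfolding negpart_def by (intro le_supI1) simp
    then show False using unit[of "r - N"] that \<open>\<not> r \<le> N\<close> unfolding L_def by simp
  qed
  then have bdd: "bdd_above L" by (auto simp: bdd_above_def)
  define r where "r = Sup L"
  have "a - of_real r \<in> M"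
  proof (rule ccontr)
    assume "a - of_real r \<notin> M"
    then obtain m and n :: nat where m: "m \<in> M" "0 \<le> m" "1 \<le> m + of_nat n * labs (a - of_real r)"
      using maximal_l_ideal_adjoin[OF M(1) max] by blast
    \<comment> \<open>An error of \<delta> in \<open>labs (a - of_real r)\<close> then costs at most
      1/2 after multiplication by \<open>n\<close>; the summand 1 covers
      \<open>n = 0\<close>.\<close>
    define \<delta> where "\<delta> = 1 / (2 * (real n + 1))"
    have \<delta>: "\<delta> > 0" "real n * \<delta> \<le> 1 / 2" by (auto simp: \<delta>_def field_simps)
    obtain s where s: "s \<in> L" "r - \<delta> < s"
      using less_cSup_iff[OF _ bdd, of "r - \<delta>"] \<open>- N \<in> L\<close> \<delta> unfolding r_def by auto
    \<comment> \<open>Above the supremum primeness puts the positive part into \<open>M\<close>; at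
      \<open>s\<close>, just below it, the negative part is in \<open>M\<close>. Together they bound
      \<open>labs (a - of_real r)\<close> by \<delta> modulo \<open>M\<close>.\<close>
    have "r + \<delta> \<notin> L" using cSup_upper[OF _ bdd, of "r + \<delta>"] \<delta> unfolding r_def by auto
    then have "negpart (a - of_real (r + \<delta>)) \<notin> M" unfolding L_def by simp
    then have p: "pospart (a - of_real (r + \<delta>)) \<in> M"
      using prime[of "negpart (a - of_real (r + \<delta>))"] pospart_mult_negpart by (metis mult.commute pospart_nonneg negpart_nonneg)
    have q: "negpart (a - of_real s) \<in> M" using s unfolding L_def by simp
    let ?w = "pospart (a - of_real (r + \<delta>)) + negpart (a - of_real s)"
    have "a - of_real (r + \<delta>) \<le> ?w" "- (a - of_real s) \<le> ?w"
      unfolding pospart_def negpart_def by (auto intro: add_increasing add_increasing2)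
    moreover have "(of_real r :: 'a) - of_real \<delta> \<le> of_real s"
      using of_real_mono_bal[of "r - \<delta>" s] s by simp
    ultimately have "a - of_real (r + \<delta>) + of_real \<delta> \<le> ?w + of_real \<delta>"
      "- (a - of_real s) + (of_real r - of_real s) \<le> ?w + of_real \<delta>"
      by (metis add_right_mono, metis add_mono diff_le_eq add.commute)
    then have "a - of_real r \<le> ?w + of_real \<delta>" "- (a - of_real r) \<le> ?w + of_real \<delta>"
      by simp_all
    then have "labs (a - of_real r) \<le> ?w + of_real \<delta>" by (simp add: labs_le_iff)
    then have "of_nat n * labs (a - of_real r) \<le> of_nat n * (?w + of_real \<delta>)" by (rule mult_left_mono) simp
    also have "\<dots> = of_nat n * ?w + of_real (real n * \<delta>)" by (simp add: distrib_left)
    also have "\<dots> \<le> of_nat n * ?w + of_real (1 / 2)"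
      using \<delta>(2) by (intro add_left_mono of_real_mono_bal)
    finally have "1 \<le> m + (of_nat n * ?w + of_real (1 / 2))" using m(3) order_trans add_left_mono by blast
    then have "1 - of_real (1 / 2) \<le> m + of_nat n * ?w" by (simp add: algebra_simps)
    moreover have "1 - of_real (1 / 2) = (of_real (1 / 2) :: 'a)" by (metis of_real_1 of_real_diff field_sum_of_halves add_diff_cancel_right')
    moreover have "m + of_nat n * ?w \<in> M" using m(1) p q by (intro l_ideal_add l_ideal_mult M)
    ultimately show False using unit[of "1/2"] by simp
  qed
  then show ?thesis ..
qed

text \<open>The hypothesis keeps 1 out of the ideal generated by \<open>P\<close>. It is spelled out
  with finite sums because one use refutes such an inequality and the other extracts a finite set
  from it.\<close>

lemma point_vanishing_on:
  fixes P :: "'a::ba_algebra set"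
  assumes "\<And>F (n::nat). finite F \<Longrightarrow> F \<subseteq> P \<Longrightarrow> \<not> 1 \<le> of_nat n * (\<Sum>p\<in>F. labs p)"
  obtains \<phi> :: "'a \<Rightarrow> real" where "bal_hom \<phi>" "\<And>p. p \<in> P \<Longrightarrow> \<phi> p = 0"
proof -
  have "1 \<notin> l_ideal_gen P"
    using assms unfolding l_ideal_gen_def by (auto simp: labs_of_nonneg zero_le_one_bal)
  then obtain M where M: "l_ideal M" "1 \<notin> M" "l_ideal_gen P \<subseteq> M"
    and max: "\<And>N. l_ideal N \<Longrightarrow> M \<subseteq> N \<Longrightarrow> 1 \<notin> N \<Longrightarrow> N = M"
    using maximal_l_ideal_exists[OF l_ideal_l_ideal_gen] by blast
  obtain \<phi> :: "'a \<Rightarrow> real" where "bal_hom \<phi>" "\<And>a. \<phi> a = 0 \<longleftrightarrow> a \<in> M"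
    using l_ideal_point[OF M(1,2) maximal_l_ideal_real_quotient[OF M(1,2) max]] by blast
  then show ?thesis using that M(3) l_ideal_gen_superset[of P] by blast
qed

section \<open>Archimedean ideals and the atoms of the free boolean extension\<close>

lemma bal_hom_add: "bal_hom f \<Longrightarrow> f (a + b) = f a + f b"
  and bal_hom_mult: "bal_hom f \<Longrightarrow> f (a * b) = f a * f b"
  and bal_hom_scaleR: "bal_hom f \<Longrightarrow> f (r *\<^sub>R a) = r *\<^sub>R f a"
  and bal_hom_one: "bal_hom f \<Longrightarrow> f 1 = 1"
  and bal_hom_sup: "bal_hom f \<Longrightarrow> f (sup a b) = sup (f a) (f b)"
  and bal_hom_inf: "bal_hom f \<Longrightarrow> f (inf a b) = inf (f a) (f b)"
  by (simp_all add: bal_hom_def)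

lemma bal_hom_zero: "bal_hom f \<Longrightarrow> f 0 = 0"
  using bal_hom_add[of f 0 0] by simp

lemma bal_hom_uminus: "bal_hom f \<Longrightarrow> f (- a) = - f a"
  using bal_hom_scaleR[of f "-1" a] by simp

lemma bal_hom_diff: "bal_hom f \<Longrightarrow> f (a - b) = f a - f b"
  using bal_hom_add[of f "a - b" b] by simp

lemma bal_hom_of_real: "bal_hom f \<Longrightarrow> f (of_real r) = of_real r"
  by (simp add: of_real_def bal_hom_scaleR bal_hom_one)

lemma bal_hom_of_nat: "bal_hom f \<Longrightarrow> f (of_nat n) = of_nat n"
  using bal_hom_of_real[of f "real n"] by simp

lemma bal_hom_mono: "bal_hom f \<Longrightarrow> a \<le> b \<Longrightarrow> f a \<le> f b"
  by (metis bal_hom_sup le_iff_sup)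

lemma bal_hom_pospart: "bal_hom f \<Longrightarrow> f (pospart a) = pospart (f a)"
  by (simp add: pospart_def bal_hom_sup bal_hom_zero)

lemma bal_hom_negpart: "bal_hom f \<Longrightarrow> f (negpart a) = negpart (f a)"
  by (simp add: negpart_def bal_hom_sup bal_hom_zero bal_hom_uminus)

lemma bal_hom_labs: "bal_hom f \<Longrightarrow> f (labs a) = labs (f a)"
  by (simp add: labs_def bal_hom_sup bal_hom_uminus)

lemma pospart_eq_0_iff: "pospart a = 0 \<longleftrightarrow> a \<le> 0"
  by (metis le_iff_sup pospart_def)

lemma negpart_eq_0_iff: "negpart a = 0 \<longleftrightarrow> 0 \<le> a"
  using pospart_eq_0_iff[of "- a"] by (simp add: pospart_uminus)

lemma labs_eq_0_iff: "labs a = 0 \<longleftrightarrow> a = 0"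
  by (simp add: labs_def)

lemma labs_zero [simp]: "labs 0 = 0"
  by (simp add: labs_def)

lemma labs_le_0_iff: "labs a \<le> 0 \<longleftrightarrow> a = 0"
  using labs_eq_0_iff[of a] antisym[OF _ labs_nonneg[of a]] by auto

section \<open>Archimedean \<ell>-ideals and kernels of points\<close>

lemma Inter_Arch:
  assumes "\<K> \<subseteq> Arch" shows "\<Inter>\<K> \<in> Arch"
proof -
  have K: "l_ideal K" "\<And>a b. (\<forall>n::nat. n \<ge> 1 \<longrightarrow> quot_le K (of_nat n * a) b) \<Longrightarrow> quot_le K a 0" if "K \<in> \<K>" for K
    using that assms unfolding Arch_def arch_ideal_def by auto
  have "l_ideal (\<Inter>\<K>)"
    unfolding l_ideal_def ring_ideal_def
  proof (intro conjI ballI allI impI InterI)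
    fix K assume "K \<in> \<K>"
    then show "0 \<in> K" using K(1) l_ideal_zero by blast
  next
    fix K a b assume "K \<in> \<K>" "a \<in> \<Inter>\<K>" "b \<in> \<Inter>\<K>"
    then show "a + b \<in> K" using K(1)[of K] l_ideal_add[of K a b] by blast
  next
    fix K and a c :: 'a assume "K \<in> \<K>" "a \<in> \<Inter>\<K>"
    then show "c * a \<in> K" using K(1)[of K] l_ideal_mult[of K a c] by blast
  next
    fix K and a b :: 'a assume "K \<in> \<K>" "labs a \<le> labs b \<and> b \<in> \<Inter>\<K>"
    then show "a \<in> K" using K(1)[of K] unfolding l_ideal_def by blast
  qed
  moreover have "quot_le (\<Inter>\<K>) a 0" if "\<forall>n::nat. n \<ge> 1 \<longrightarrow> quot_le (\<Inter>\<K>) (of_nat n * a) b" for a b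
    using that K(2)[of _ a b] unfolding quot_le_def by blast
  ultimately show ?thesis unfolding Arch_def arch_ideal_def by blast
qed

lemma Int_Arch: "I \<in> Arch \<Longrightarrow> J \<in> Arch \<Longrightarrow> I \<inter> J \<in> Arch"
  using Inter_Arch[of "{I, J}"] by simp

lemma arch_join_Arch: "arch_join I J \<in> Arch"
  unfolding arch_join_def by (rule Inter_Arch) blast

lemma UNIV_Arch: "UNIV \<in> Arch"
  using Inter_Arch[of "{}"] by simp

lemma zero_Arch: "{0} \<in> Arch"
proof -
  have "l_ideal {0::'a}"
    unfolding l_ideal_def ring_ideal_def
  proof (intro conjI ballI allI impI)
    fix a b :: 'a assume "labs a \<le> labs b \<and> b \<in> {0}"
    then have "labs a \<le> 0" by auto
    then show "a \<in> {0}" by (simp add: labs_le_0_iff)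
  qed auto
  then show ?thesis
    unfolding Arch_def arch_ideal_def quot_le_def using bal_archimedean
    by (auto simp: pospart_eq_0_iff)
qed

definition pt_ker :: "('a::ba_algebra \<Rightarrow> real) \<Rightarrow> 'a set" where
  "pt_ker \<phi> = {a. \<phi> a = 0}"

lemma pt_ker_Arch:
  assumes "bal_hom \<phi>" shows "pt_ker \<phi> \<in> Arch"
proof -
  note hom = bal_hom_add[OF assms] bal_hom_mult[OF assms] bal_hom_zero[OF assms]
    bal_hom_diff[OF assms] bal_hom_of_nat[OF assms] bal_hom_pospart[OF assms]
  have "l_ideal (pt_ker \<phi>)"
    unfolding l_ideal_def ring_ideal_def
  proof (intro conjI ballI allI impI)
    fix a b assume "labs a \<le> labs b \<and> b \<in> pt_ker \<phi>"
    then have "labs (\<phi> a) \<le> labs 0"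
      using bal_hom_mono[OF assms, of "labs a" "labs b"] by (simp add: bal_hom_labs[OF assms] pt_ker_def)
    then show "a \<in> pt_ker \<phi>"
      by (simp add: pt_ker_def labs_le_0_iff)
  qed (auto simp: pt_ker_def hom)
  moreover have "quot_le (pt_ker \<phi>) a 0"
    if "\<forall>n::nat. n \<ge> 1 \<longrightarrow> quot_le (pt_ker \<phi>) (of_nat n * a) b" for a b
  proof -
    have "\<phi> a \<le> 0"
      using that by (intro bal_archimedean[of "\<phi> a" "\<phi> b"])
        (simp add: quot_le_def pt_ker_def hom pospart_eq_0_iff)
    then show ?thesis by (simp add: quot_le_def pt_ker_def hom pospart_eq_0_iff)
  qed
  ultimately show ?thesis unfolding Arch_def arch_ideal_def by blast
qed

text \<open>Both \<open>a\<close> and \<open>a - of_real (\<phi> a)\<close> lie in \<open>K\<close>,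
  and their difference is a nonzero constant.\<close>

lemma pt_ker_maximal:
  assumes "bal_hom \<phi>" "K \<in> Arch" "pt_ker \<phi> \<subseteq> K" "a \<in> K" "\<phi> a \<noteq> 0"
  shows "K = UNIV"
proof -
  have K: "l_ideal K" using assms(2) by (simp add: Arch_def arch_ideal_def)
  have "a - of_real (\<phi> a) \<in> K"
    using assms(3) by (auto simp: pt_ker_def bal_hom_diff[OF assms(1)] bal_hom_of_real[OF assms(1)])
  then have "a - (a - of_real (\<phi> a)) \<in> K"
    by (rule l_ideal_diff[OF K assms(4)])
  then show ?thesis using l_ideal_of_real[OF K, of "\<phi> a"] assms(5) by simp
qed

lemma pt_ker_eqD:
  assumes "bal_hom \<phi>" "bal_hom \<psi>" "pt_ker \<phi> \<subseteq> pt_ker \<psi>"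
  shows "\<phi> = \<psi>"
proof
  fix a
  have "a - of_real (\<phi> a) \<in> pt_ker \<phi>"
    by (simp add: pt_ker_def bal_hom_diff[OF assms(1)] bal_hom_of_real[OF assms(1)])
  then have "a - of_real (\<phi> a) \<in> pt_ker \<psi>" using assms(3) by blast
  then show "\<phi> a = \<psi> a"
    by (simp add: pt_ker_def bal_hom_diff[OF assms(2)] bal_hom_of_real[OF assms(2)])
qed

text \<open>As \<open>J\<close> is archimedean, some \<open>v = of_nat n * labs a - 1\<close> is not
  nonpositive modulo \<open>J\<close>. A point killing \<open>J\<close> and \<open>negpart v\<close>
  satisfies \<open>n * labs (\<phi> a) \<ge> 1\<close>. If there were none, 1 would lie below some
  \<open>m + k * negpart v\<close> with \<open>m\<close> in \<open>J\<close>, and multiplying by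
  \<open>pospart v\<close> would put \<open>pospart v\<close> into \<open>J\<close>.\<close>

lemma Arch_separating_point:
  fixes a :: "'a::ba_algebra"
  assumes J: "J \<in> Arch" and a: "a \<notin> J"
  obtains \<phi> :: "'a \<Rightarrow> real" where "bal_hom \<phi>" "J \<subseteq> pt_ker \<phi>" "\<phi> a \<noteq> 0"
proof -
  have lJ: "l_ideal J" using J by (simp add: Arch_def arch_ideal_def)
  have "labs a \<notin> J" using l_ideal_le[OF lJ, of "labs a" a] a by blast
  then have "\<not> quot_le J (labs a) 0"
    by (simp add: quot_le_def pospart_def sup_absorb1)
  then obtain n :: nat where n: "\<not> quot_le J (of_nat n * labs a) 1"
    using J unfolding Arch_def arch_ideal_def by blast
  define v where "v = of_nat n * labs a - 1"
  have v: "pospart v \<notin> J" using n by (simp add: quot_le_def v_def)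
  obtain \<phi> :: "'a \<Rightarrow> real" where \<phi>: "bal_hom \<phi>" "\<And>p. p \<in> insert (negpart v) J \<Longrightarrow> \<phi> p = 0"
  proof (rule point_vanishing_on[of "insert (negpart v) J"])
    fix F and k :: nat assume F: "finite F" "F \<subseteq> insert (negpart v) J"
    show "\<not> 1 \<le> of_nat k * (\<Sum>p\<in>F. labs p)"
    proof
      assume "1 \<le> of_nat k * (\<Sum>p\<in>F. labs p)"
      then obtain m where m: "m \<in> J" "0 \<le> m" "1 \<le> m + of_nat k * labs (negpart v)"
        using l_ideal_adjoin_split[OF lJ F] by blast
      have "pospart v * 1 \<le> pospart v * (m + of_nat k * labs (negpart v))"
        using m(3) by (intro mult_left_mono) auto
      also have "\<dots> = pospart v * m + of_nat k * (pospart v * negpart v)"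
        by (simp add: labs_of_nonneg algebra_simps)
      finally have "labs (pospart v) \<le> pospart v * m"
        by (simp add: labs_of_nonneg pospart_mult_negpart)
      then have "pospart v \<in> J" using l_ideal_le[OF lJ l_ideal_mult[OF lJ m(1)]] by blast
      with v show False ..
    qed
  qed blast
  have "negpart (\<phi> v) = 0" using \<phi>(2)[of "negpart v"] bal_hom_negpart[OF \<phi>(1), of v] by simp
  then have "0 \<le> \<phi> v" by (simp add: negpart_eq_0_iff)
  then have "1 \<le> real n * labs (\<phi> a)"
    unfolding v_def by (simp add: bal_hom_diff[OF \<phi>(1)] bal_hom_mult[OF \<phi>(1)] bal_hom_of_nat[OF \<phi>(1)]
        bal_hom_one[OF \<phi>(1)] bal_hom_labs[OF \<phi>(1)])
  then have "\<phi> a \<noteq> 0" by (auto simp: labs_def)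
  moreover have "J \<subseteq> pt_ker \<phi>" using \<phi>(2) by (auto simp: pt_ker_def)
  ultimately show ?thesis using that \<phi>(1) by blast
qed

lemma points_reflect_le:
  fixes a b :: "'a::ba_algebra"
  assumes "\<And>\<phi> :: 'a \<Rightarrow> real. bal_hom \<phi> \<Longrightarrow> \<phi> a \<le> \<phi> b"
  shows "a \<le> b"
proof (rule ccontr)
  assume "\<not> a \<le> b"
  then have "pospart (a - b) \<notin> {0}" by (simp add: pospart_eq_0_iff)
  then obtain \<phi> :: "'a \<Rightarrow> real" where \<phi>: "bal_hom \<phi>" "\<phi> (pospart (a - b)) \<noteq> 0"
    using Arch_separating_point[OF zero_Arch] by blast
  then have "pospart (\<phi> a - \<phi> b) \<noteq> 0"
    by (simp add: bal_hom_pospart[OF \<phi>(1)] bal_hom_diff[OF \<phi>(1)])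
  with assms[OF \<phi>(1)] show False by (simp add: pospart_eq_0_iff)
qed

section \<open>Atomicity of the free boolean extension\<close>

lemma bool_generated_induct:
  assumes "b \<in> bool_generated G" "\<And>g. g \<in> G \<Longrightarrow> P g" "P bot" "P top"
    "\<And>x y. P x \<Longrightarrow> P y \<Longrightarrow> P (inf x y)" "\<And>x y. P x \<Longrightarrow> P y \<Longrightarrow> P (sup x y)"
    "\<And>x. P x \<Longrightarrow> P (- x)"
  shows "P b"
proof -
  have "bool_generated G \<subseteq> {x. P x}"
    unfolding bool_generated_def using assms(2-) by (intro Inter_lower) auto
  with assms(1) show ?thesis by blast
qed

locale arch_free_extension =
  fixes j :: "'a::ba_algebra set \<Rightarrow> 'b::boolean_algebra"
  assumes free: "free_bool_ext j"
begin

lemma j_inf: "I \<in> Arch \<Longrightarrow> J \<in> Arch \<Longrightarrow> j (I \<inter> J) = inf (j I) (j J)"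
  and j_sup: "I \<in> Arch \<Longrightarrow> J \<in> Arch \<Longrightarrow> j (arch_join I J) = sup (j I) (j J)"
  and j_inj: "I \<in> Arch \<Longrightarrow> J \<in> Arch \<Longrightarrow> j I = j J \<Longrightarrow> I = J"
  and j_bot: "j {0} = bot" and j_top: "j UNIV = top"
  using free by (auto simp: free_bool_ext_def inj_on_def)

lemma j_mono: "I \<in> Arch \<Longrightarrow> J \<in> Arch \<Longrightarrow> I \<subseteq> J \<Longrightarrow> j I \<le> j J"
  using j_inf[of I J] by (simp add: inf.absorb1 le_iff_inf)

text \<open>If \<open>j I\<close> is pictured as the set of points that do not vanish identically on
  \<open>I\<close>, this is the singleton of \<phi>.\<close>

definition atom :: "('a \<Rightarrow> real) \<Rightarrow> 'b" where
  "atom \<phi> = - j (pt_ker \<phi>)"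

lemma atom_le_compl: "bal_hom \<phi> \<Longrightarrow> I \<in> Arch \<Longrightarrow> I \<subseteq> pt_ker \<phi> \<Longrightarrow> atom \<phi> \<le> - j I"
  unfolding atom_def using j_mono[OF _ pt_ker_Arch] by (simp add: compl_mono)

text \<open>The kernel is maximal, so its join with \<open>I\<close> is the whole algebra, and
  \<open>j\<close> turns this into a join equal to top.\<close>

lemma atom_le:
  assumes "bal_hom \<phi>" "I \<in> Arch" "\<not> I \<subseteq> pt_ker \<phi>" shows "atom \<phi> \<le> j I"
proof -
  obtain a where a: "a \<in> I" "\<phi> a \<noteq> 0" using assms(3) by (auto simp: pt_ker_def)
  have "arch_join I (pt_ker \<phi>) = UNIV"
    using a unfolding arch_join_def by (auto dest: pt_ker_maximal[OF assms(1)])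
  then have "sup (j I) (j (pt_ker \<phi>)) = top"
    using j_sup[OF assms(2) pt_ker_Arch[OF assms(1)]] j_top by simp
  then show ?thesis unfolding atom_def by (metis sup_shunt sup_commute)
qed

text \<open>Maximality of the kernel settles the generators, and boolean operations preserve the
  dichotomy. Together with \<open>atom_nonbot\<close> it makes \<open>atom \<phi>\<close> an
  atom.\<close>

lemma atom_le_or: "bal_hom \<phi> \<Longrightarrow> atom \<phi> \<le> b \<or> atom \<phi> \<le> - b"
proof -
  assume \<phi>: "bal_hom \<phi>"
  have "b \<in> bool_generated (j ` Arch)" using free by (simp add: free_bool_ext_def)
  then show ?thesis
  proof (rule bool_generated_induct)
    show "atom \<phi> \<le> g \<or> atom \<phi> \<le> - g" if "g \<in> j ` Arch" for g
      using that atom_le[OF \<phi>] atom_le_compl[OF \<phi>] by blast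
  qed (auto intro: le_infI1 le_infI2 le_supI1 le_supI2)
qed

lemma atom_nonbot:
  assumes "bal_hom \<phi>" shows "atom \<phi> \<noteq> bot"
proof
  assume "atom \<phi> = bot"
  then have "j (pt_ker \<phi>) = j UNIV" unfolding atom_def j_top by (metis compl_eq_compl_iff compl_top_eq)
  then have "pt_ker \<phi> = UNIV" using j_inj pt_ker_Arch[OF assms] UNIV_Arch by blast
  then have "1 \<in> pt_ker \<phi>" by simp
  then show False using bal_hom_one[OF assms] by (simp add: pt_ker_def)
qed

lemma atom_disjoint:
  assumes "bal_hom \<phi>" "bal_hom \<psi>" "\<phi> \<noteq> \<psi>" shows "inf (atom \<phi>) (atom \<psi>) = bot"
proof -
  have "atom \<psi> \<le> j (pt_ker \<phi>)"
    using assms by (intro atom_le pt_ker_Arch) (auto dest: pt_ker_eqD)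
  then show ?thesis unfolding atom_def[of \<phi>] by (metis inf_shunt inf_commute double_compl)
qed

text \<open>A nonzero \<open>c\<close> of this kind lies within one cell of the partition cut out by
  the elements \<open>j I\<close> with \<open>I\<close> in \<open>F\<close>.\<close>

definition decides :: "'a set set \<Rightarrow> 'b \<Rightarrow> bool" where
  "decides F c \<longleftrightarrow> (\<forall>I\<in>F. c \<le> j I \<or> c \<le> - j I)"

lemma decides_antimono: "decides F c \<Longrightarrow> c' \<le> c \<Longrightarrow> decides F c'"
  unfolding decides_def using order_trans by blast

text \<open>Each \<open>b\<close> is a boolean combination of finitely many generators, and what
  these do not split, \<open>b\<close> does not split.\<close>

lemma finitely_decided: "\<exists>F. finite F \<and> F \<subseteq> Arch \<and> (\<forall>c. decides F c \<longrightarrow> c \<le> b \<or> c \<le> - b)"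
proof -
  have "b \<in> bool_generated (j ` Arch)" using free by (simp add: free_bool_ext_def)
  then show ?thesis
  proof (rule bool_generated_induct)
    fix g assume "g \<in> j ` Arch"
    then obtain I where I: "I \<in> Arch" "g = j I" by blast
    then show "\<exists>F. finite F \<and> F \<subseteq> Arch \<and> (\<forall>c. decides F c \<longrightarrow> c \<le> g \<or> c \<le> - g)"
      by (intro exI[of _ "{I}"]) (auto simp: decides_def)
  next
    fix y z
    assume "\<exists>F. finite F \<and> F \<subseteq> Arch \<and> (\<forall>c. decides F c \<longrightarrow> c \<le> y \<or> c \<le> - y)"
      and "\<exists>F. finite F \<and> F \<subseteq> Arch \<and> (\<forall>c. decides F c \<longrightarrow> c \<le> z \<or> c \<le> - z)"
    then obtain F G where F: "finite F" "F \<subseteq> Arch" "\<And>c. decides F c \<Longrightarrow> c \<le> y \<or> c \<le> - y"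
      and G: "finite G" "G \<subseteq> Arch" "\<And>c. decides G c \<Longrightarrow> c \<le> z \<or> c \<le> - z" by blast
    have dec: "(c \<le> y \<or> c \<le> - y) \<and> (c \<le> z \<or> c \<le> - z)" if "decides (F \<union> G) c" for c
      using F(3)[of c] G(3)[of c] that by (simp add: decides_def)
    show "\<exists>F. finite F \<and> F \<subseteq> Arch \<and> (\<forall>c. decides F c \<longrightarrow> c \<le> inf y z \<or> c \<le> - inf y z)"
      using F(1,2) G(1,2) dec
      by (intro exI[of _ "F \<union> G"]) (auto intro: le_supI1 le_supI2 dest!: dec)
    show "\<exists>F. finite F \<and> F \<subseteq> Arch \<and> (\<forall>c. decides F c \<longrightarrow> c \<le> sup y z \<or> c \<le> - sup y z)"
      using F(1,2) G(1,2) dec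
      by (intro exI[of _ "F \<union> G"]) (auto intro: le_supI1 le_supI2 dest!: dec)
  qed auto
qed

text \<open>Splitting \<open>b\<close> along one generator at a time always leaves a nonzero piece.
  Cells keep the form \<open>inf (j I) (- j J)\<close> because the image of \<open>j\<close> is
  closed under finite meets and joins.\<close>

lemma cell_exists:
  assumes "finite F" "F \<subseteq> Arch" "b \<noteq> bot"
  shows "\<exists>I\<in>Arch. \<exists>J\<in>Arch. decides F (inf (j I) (- j J)) \<and> inf b (inf (j I) (- j J)) \<noteq> bot"
  using assms(1,2)
proof (induction F rule: finite_induct)
  case empty
  then show ?case
    using assms(3) UNIV_Arch zero_Arch
    by (intro bexI[of _ UNIV] bexI[of _ "{0}"]) (auto simp: decides_def j_top j_bot)
next
  case (insert K F)
  then obtain I J where IJ: "I \<in> Arch" "J \<in> Arch" "decides F (inf (j I) (- j J))"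
    "inf b (inf (j I) (- j J)) \<noteq> bot" and K: "K \<in> Arch" by auto
  let ?c = "inf (j I) (- j J)"
  have "inf b ?c = sup (inf b (inf ?c (j K))) (inf b (inf ?c (- j K)))"
    by (metis inf_sup_distrib1 inf_top_right sup_compl_top)
  then consider "inf b (inf ?c (j K)) \<noteq> bot" | "inf b (inf ?c (- j K)) \<noteq> bot"
    using IJ(4) by fastforce
  then show ?case
  proof cases
    case 1
    have eq: "inf (j (I \<inter> K)) (- j J) = inf ?c (j K)"
      using j_inf[OF IJ(1) K] by (simp add: inf_commute inf_left_commute)
    have "decides (insert K F) (inf ?c (j K))"
      using decides_antimono[OF IJ(3) inf_le1] by (auto simp: decides_def)
    then show ?thesis using 1 IJ K Int_Arch unfolding eq[symmetric] by blast
  next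
    case 2
    have eq: "inf (j I) (- j (arch_join J K)) = inf ?c (- j K)"
      using j_sup[OF IJ(2) K] by (simp add: inf_assoc)
    have "decides (insert K F) (inf ?c (- j K))"
      using decides_antimono[OF IJ(3) inf_le1] by (auto simp: decides_def)
    then show ?thesis using 2 IJ K arch_join_Arch unfolding eq[symmetric] by blast
  qed
qed

text \<open>A decided cell that meets \<open>b\<close> lies below \<open>b\<close>. Being nonzero,
  it has \<open>I\<close> not contained in \<open>J\<close>, and a point that kills \<open>J\<close>
  but not all of \<open>I\<close> has its atom in the cell.\<close>

lemma atom_below:
  assumes "b \<noteq> bot"
  obtains \<phi> where "bal_hom \<phi>" "atom \<phi> \<le> b"
proof -
  obtain F where F: "finite F" "F \<subseteq> Arch" "\<And>c. decides F c \<Longrightarrow> c \<le> b \<or> c \<le> - b"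
    using finitely_decided by blast
  obtain I J where IJ: "I \<in> Arch" "J \<in> Arch" "decides F (inf (j I) (- j J))"
    "inf b (inf (j I) (- j J)) \<noteq> bot"
    using cell_exists[OF F(1,2) assms] by blast
  have "\<not> inf (j I) (- j J) \<le> - b"
    using IJ(4) by (metis double_compl inf_shunt inf_commute)
  then have le: "inf (j I) (- j J) \<le> b" using F(3) IJ(3) by blast
  have "inf (j I) (- j J) \<noteq> bot" using IJ(4) by auto
  then have "\<not> I \<subseteq> J" using j_mono[OF IJ(1,2)] by (auto simp: inf_shunt)
  then obtain a where a: "a \<in> I" "a \<notin> J" by blast
  obtain \<phi> where \<phi>: "bal_hom \<phi>" "J \<subseteq> pt_ker \<phi>" "\<phi> a \<noteq> 0"
    using Arch_separating_point[OF IJ(2) a(2)] by blast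
  have "atom \<phi> \<le> j I" using a \<phi> by (intro atom_le IJ) (auto simp: pt_ker_def)
  moreover have "atom \<phi> \<le> - j J" using \<phi> IJ by (intro atom_le_compl)
  ultimately have "atom \<phi> \<le> b" using le by (metis le_inf_iff order_trans)
  with \<phi>(1) show ?thesis using that by blast
qed

end

section \<open>Evaluation of polynomials\<close>

lemma monom_eval_superset:
  "finite A \<Longrightarrow> Poly_Mapping.keys m \<subseteq> A \<Longrightarrow> monom_eval x m = (\<Prod>e\<in>A. x e ^ Poly_Mapping.lookup m e)"
  unfolding monom_eval_def by (rule prod.mono_neutral_left) (auto simp: in_keys_iff)

lemma monom_eval_add: "monom_eval x (m + n) = monom_eval x m * monom_eval x n"
proof -
  let ?A = "Poly_Mapping.keys m \<union> Poly_Mapping.keys n"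
  have "Poly_Mapping.keys (m + n) \<subseteq> ?A" by (rule Poly_Mapping.keys_add)
  then show ?thesis
    by (simp add: monom_eval_superset[of ?A] lookup_add power_add prod.distrib)
qed

lemma peval_superset:
  "finite A \<Longrightarrow> Poly_Mapping.keys p \<subseteq> A \<Longrightarrow> peval x p = (\<Sum>m\<in>A. Poly_Mapping.lookup p m *\<^sub>R monom_eval x m)"
  unfolding peval_def by (rule sum.mono_neutral_left) (auto simp: in_keys_iff)

lemma peval_add: "peval x (p + q) = peval x p + peval x q"
proof -
  let ?A = "Poly_Mapping.keys p \<union> Poly_Mapping.keys q"
  have "Poly_Mapping.keys (p + q) \<subseteq> ?A" by (rule Poly_Mapping.keys_add)
  then show ?thesis
    by (simp add: peval_superset[of ?A] lookup_add scaleR_left_distrib sum.distrib)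
qed

lemma peval_zero: "peval x 0 = 0"
  by (simp add: peval_def)

lemma peval_diff: "peval x (p - q) = peval x p - peval x q"
  using peval_add[of x "p - q" q] by simp

lemma peval_sum: "peval x (sum f A) = (\<Sum>i\<in>A. peval x (f i))"
  by (induction A rule: infinite_finite_induct) (auto simp: peval_zero peval_add)

lemma peval_single: "peval x (Poly_Mapping.single m c) = c *\<^sub>R monom_eval x m"
  by (simp add: peval_superset[of "{m}"])

lemma poly_mapping_eq_sum_single:
  "p = (\<Sum>m\<in>Poly_Mapping.keys p. Poly_Mapping.single m (Poly_Mapping.lookup p m))"
  by (rule poly_mapping_eqI) (simp add: lookup_sum lookup_single when_def in_keys_iff)

lemma peval_mult: "peval x (p * q) = peval x p * peval x q"
proof -
  have "p * q = (\<Sum>m\<in>Poly_Mapping.keys p. \<Sum>n\<in>Poly_Mapping.keys q.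
      Poly_Mapping.single (m + n) (Poly_Mapping.lookup p m * Poly_Mapping.lookup q n))"
    by (subst poly_mapping_eq_sum_single[of p], subst poly_mapping_eq_sum_single[of q])
      (simp add: sum_product mult_single)
  then show ?thesis
    by (simp add: peval_sum peval_single monom_eval_add sum_product
        peval_def[of x p] peval_def[of x q] mult.commute)
qed

lemma peval_one: "peval x 1 = 1"
  using peval_single[of x 0 1] by (simp add: monom_eval_def)

lemma peval_pvar: "peval x (pvar e) = x e"
  by (simp add: pvar_def peval_single monom_eval_superset[of "{e}"])

text \<open>Serves twice: for the embedding into \<open>D\<close>, and in
  \<open>x_atom_nonzero\<close> for the real evaluation at an atom.\<close>

lemma peval_RB_gens_iff:
  "(\<forall>g\<in>RB_gens. peval x g = 0) \<longleftrightarrow>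
     (\<forall>e f. x (inf e f) = x e * x f) \<and> (\<forall>e f. x (sup e f) = x e + x f - x e * x f) \<and>
     (\<forall>e. x (- e) = 1 - x e) \<and> x bot = 0"
proof -
  have "(\<forall>g\<in>RB_gens. peval x g = 0) \<longleftrightarrow>
      (\<forall>e f. peval x (pvar (inf e f) - pvar e * pvar f) = 0) \<and>
      (\<forall>e f. peval x (pvar (sup e f) - (pvar e + pvar f - pvar e * pvar f)) = 0) \<and>
      (\<forall>e. peval x (pvar (- e) - (1 - pvar e)) = 0) \<and> peval x (pvar bot) = 0"
    unfolding RB_gens_def by blast
  then show ?thesis
    by (simp add: peval_diff peval_add peval_mult peval_pvar peval_one)
qed

lemma RB_ideal_peval:
  assumes "\<forall>g\<in>RB_gens. peval x g = 0" "p \<in> RB_ideal"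
  shows "peval x p = 0"
proof -
  have "ring_ideal {p. peval x p = 0}"
    by (auto simp: ring_ideal_def peval_zero peval_add peval_mult)
  then show ?thesis using assms unfolding RB_ideal_def by blast
qed

text \<open>Here \<open>y\<close> is a common eigenvector of multiplication by the variables. It
  will be the idempotent of an element of \<open>B\<close> that no variable involved splits.\<close>

lemma monom_eval_eigen:
  fixes h :: "'b \<Rightarrow> real" and y :: "'d::{comm_ring_1, real_algebra_1}"
  assumes "\<And>e. e \<in> Poly_Mapping.keys m \<Longrightarrow> x e * y = h e *\<^sub>R y"
  shows "monom_eval x m * y = monom_eval h m *\<^sub>R y"
proof -
  have pow: "x e ^ n * y = h e ^ n *\<^sub>R y" if "e \<in> Poly_Mapping.keys m" for e n
    using assms[OF that] by (induction n) (auto simp: mult.assoc)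
  have "(\<Prod>e\<in>A. x e ^ Poly_Mapping.lookup m e) * y = (\<Prod>e\<in>A. h e ^ Poly_Mapping.lookup m e) *\<^sub>R y"
    if "A \<subseteq> Poly_Mapping.keys m" for A
    using finite_subset[OF that finite_keys] that
    by (induction A rule: finite_induct) (auto simp: mult.assoc pow)
  then show ?thesis unfolding monom_eval_def by blast
qed

lemma peval_eigen:
  fixes h :: "'b \<Rightarrow> real" and y :: "'d::{comm_ring_1, real_algebra_1}"
  assumes "\<And>m e. m \<in> Poly_Mapping.keys p \<Longrightarrow> e \<in> Poly_Mapping.keys m \<Longrightarrow> x e * y = h e *\<^sub>R y"
  shows "peval x p * y = peval h p *\<^sub>R y"
  unfolding peval_def sum_distrib_right scaleR_left.sum
  by (intro sum.cong refl) (simp add: monom_eval_eigen[of _ x y h] assms)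

section \<open>Evaluation on the Dedekind completion\<close>

locale arch_dedekind_completion = arch_free_extension j
  for j :: "'a::ba_algebra set \<Rightarrow> 'b::boolean_algebra" +
  fixes x :: "'b \<Rightarrow> 'd::{ba_algebra, conditionally_complete_lattice}"
  assumes completion: "dedekind_completion_RB x"
begin

lemma x_inf: "x (inf e f) = x e * x f" and x_compl: "x (- e) = 1 - x e" and x_bot: "x bot = 0"
  using completion peval_RB_gens_iff[of x] unfolding dedekind_completion_RB_def by blast+

lemma x_idem: "x e * x e = x e"
  using x_inf[of e e] by simp

lemma x_nonneg: "0 \<le> x e" and x_le_1: "x e \<le> 1"
  using idempotent_bounds[OF x_idem] by auto

lemma x_mult_le: "f \<le> e \<Longrightarrow> x e * x f = x f"
  using x_inf[of e f] by (simp add: inf_absorb2)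

lemma x_mult_le_compl: "f \<le> - e \<Longrightarrow> x e * x f = 0"
  using x_inf[of e f] by (metis double_compl inf_commute inf_shunt x_bot)

lemma join_representation:
  obtains S where "S \<subseteq> range (peval x)" "is_join S d"
  using completion unfolding dedekind_completion_RB_def by blast

text \<open>The indicator of the ultrafilter above the atom, real-valued so that it can be
  substituted into polynomials.\<close>

definition pt_val :: "('a \<Rightarrow> real) \<Rightarrow> 'b \<Rightarrow> real" where
  "pt_val \<phi> e = of_bool (atom \<phi> \<le> e)"

lemma x_mult_atom: "bal_hom \<phi> \<Longrightarrow> x e * x (atom \<phi>) = pt_val \<phi> e *\<^sub>R x (atom \<phi>)"
  using atom_le_or[of \<phi> e] by (auto simp: pt_val_def x_mult_le x_mult_le_compl)

lemma not_atom_le_both: "bal_hom \<phi> \<Longrightarrow> atom \<phi> \<le> e \<Longrightarrow> atom \<phi> \<le> - e \<Longrightarrow> False"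
  using atom_nonbot[of \<phi>] by (metis inf_compl_bot le_inf_iff le_bot)

text \<open>Evaluation at \<open>pt_val \<phi>\<close> respects the relations, so it kills
  \<open>RB_ideal\<close>, yet it sends the variable of \<open>atom \<phi>\<close> to 1. That
  variable is therefore outside the ideal and cannot become 0 in \<open>D\<close>.\<close>

lemma x_atom_nonzero:
  assumes "bal_hom \<phi>" shows "x (atom \<phi>) \<noteq> 0"
proof
  assume "x (atom \<phi>) = 0"
  then have "pvar (atom \<phi>) \<in> RB_ideal"
    using completion unfolding dedekind_completion_RB_def by (simp add: peval_pvar)
  moreover have "\<forall>g\<in>RB_gens. peval (pt_val \<phi>) g = 0"
    unfolding peval_RB_gens_iff
  proof (intro conjI allI)
    fix e f
    show "pt_val \<phi> (inf e f) = pt_val \<phi> e * pt_val \<phi> f"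
      by (auto simp: pt_val_def)
    show compl: "pt_val \<phi> (- e) = 1 - pt_val \<phi> e" for e
      using atom_le_or[OF assms, of e] not_atom_le_both[OF assms, of e] by (auto simp: pt_val_def)
    have "atom \<phi> \<le> sup e f \<longleftrightarrow> atom \<phi> \<le> e \<or> atom \<phi> \<le> f"
      using atom_le_or[OF assms, of e] atom_le_or[OF assms, of f] not_atom_le_both[OF assms, of "sup e f"]
      by (auto intro: le_supI1 le_supI2)
    then show "pt_val \<phi> (sup e f) = pt_val \<phi> e + pt_val \<phi> f - pt_val \<phi> e * pt_val \<phi> f"
      by (auto simp: pt_val_def)
    show "pt_val \<phi> bot = 0"
      using atom_nonbot[OF assms] by (simp add: pt_val_def bot_unique)
  qed
  ultimately have "pt_val \<phi> (atom \<phi>) = 0"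
    using RB_ideal_peval by (fastforce simp: peval_pvar)
  then show False by (simp add: pt_val_def)
qed

lemma scaleR_x_atom_le_iff:
  assumes "bal_hom \<phi>" shows "r *\<^sub>R x (atom \<phi>) \<le> s *\<^sub>R x (atom \<phi>) \<longleftrightarrow> r \<le> s"
proof
  assume le: "r *\<^sub>R x (atom \<phi>) \<le> s *\<^sub>R x (atom \<phi>)"
  show "r \<le> s"
  proof (rule ccontr)
    assume "\<not> r \<le> s"
    moreover have "(r - s) *\<^sub>R x (atom \<phi>) \<le> (r - s) *\<^sub>R 0"
      using le by (simp add: scaleR_diff_left)
    ultimately have "x (atom \<phi>) \<le> 0"
      using scaleR_cancel_bal[of "r - s" "x (atom \<phi>)" 0] by simp
    then show False using x_nonneg[of "atom \<phi>"] x_atom_nonzero[OF assms] antisym by blast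
  qed
qed (rule scaleR_right_mono[OF _ x_nonneg])

text \<open>Refining \<open>top\<close> along the finitely many variables of a polynomial yields an element on which
  that polynomial is a positive constant.\<close>

lemma positive_part_at_point:
  assumes "\<not> v \<le> 0"
  obtains \<phi> and r :: real where "bal_hom \<phi>" "0 < r" "r *\<^sub>R x (atom \<phi>) \<le> v * x (atom \<phi>)"
proof -
  obtain S where S: "S \<subseteq> range (peval x)" "is_join S v" by (rule join_representation)
  then obtain p where p: "peval x p \<le> v" "\<not> peval x p \<le> 0"
    using assms unfolding is_join_def by blast
  define w where "w = peval x p"
  define V where "V = (\<Union>m\<in>Poly_Mapping.keys p. Poly_Mapping.keys m)"
  have split: "\<exists>b. \<not> w * x b \<le> 0 \<and> (\<forall>e\<in>F. b \<le> e \<or> b \<le> - e)" if "finite F" for F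
    using that
  proof (induction F rule: finite_induct)
    case empty
    have "x top = 1" using x_compl[of bot] by (simp add: x_bot)
    then show ?case using p by (intro exI[of _ top]) (simp add: w_def)
  next
    case (insert e F)
    then obtain b where b: "\<not> w * x b \<le> 0" "\<forall>f\<in>F. b \<le> f \<or> b \<le> - f" by blast
    have "w * x b = w * x (inf b e) + w * x (inf b (- e))"
      by (simp add: x_inf x_compl algebra_simps)
    then obtain c where c: "\<not> w * x c \<le> 0" "c \<le> b" "c \<le> e \<or> c \<le> - e"
      using b(1) add_nonpos_nonpos by (metis inf_le1 inf_le2)
    then show ?case using b(2) by (intro exI[of _ c]) (auto intro: order_trans)
  qed
  have "finite V" by (simp add: V_def)
  from split[OF this] obtain b where b: "\<not> w * x b \<le> 0" "\<forall>e\<in>V. b \<le> e \<or> b \<le> - e" by blast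
  define r :: real where "r = peval (\<lambda>e. of_bool (b \<le> e)) p"
  have wb: "w * x b = r *\<^sub>R x b"
    unfolding w_def r_def
  proof (rule peval_eigen)
    fix m e assume "m \<in> Poly_Mapping.keys p" "e \<in> Poly_Mapping.keys m"
    then have "b \<le> e \<or> b \<le> - e" using b(2) by (auto simp: V_def)
    then show "x e * x b = of_bool (b \<le> e) *\<^sub>R x b"
      by (cases "b \<le> e") (auto simp: x_mult_le x_mult_le_compl)
  qed
  have "0 < r"
    using b(1) scaleR_right_mono[of r 0 "x b"] x_nonneg[of b] unfolding wb by force
  have "b \<noteq> bot" using b(1) x_bot by auto
  \<comment> \<open>Passing to an atom below \<open>b\<close> keeps the constant \<open>r\<close>,
    since \<open>x b\<close> acts as 1 on the idempotent of that atom.\<close>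
  then obtain \<phi> where \<phi>: "bal_hom \<phi>" "atom \<phi> \<le> b" by (rule atom_below)
  have "w * x (atom \<phi>) = w * x b * x (atom \<phi>)"
    using x_mult_le[OF \<phi>(2)] by (simp add: mult.assoc)
  also have "\<dots> = r *\<^sub>R x (atom \<phi>)"
    using x_mult_le[OF \<phi>(2)] by (simp add: wb)
  finally have "r *\<^sub>R x (atom \<phi>) \<le> v * x (atom \<phi>)"
    using mult_right_mono[OF p(1) x_nonneg[of "atom \<phi>"]] by (simp add: w_def)
  with \<phi>(1) \<open>0 < r\<close> show ?thesis by (rule that)
qed

lemma atoms_reflect_le:
  assumes "\<And>\<phi>. bal_hom \<phi> \<Longrightarrow> d * x (atom \<phi>) \<le> d' * x (atom \<phi>)"
  shows "d \<le> d'"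
proof (rule ccontr)
  assume "\<not> d \<le> d'"
  then have "\<not> d - d' \<le> 0" by simp
  then obtain \<phi> and r :: real where \<phi>: "bal_hom \<phi>" "0 < r" "r *\<^sub>R x (atom \<phi>) \<le> (d - d') * x (atom \<phi>)"
    by (rule positive_part_at_point)
  have "(d - d') * x (atom \<phi>) \<le> 0 *\<^sub>R x (atom \<phi>)"
    using assms[OF \<phi>(1)] by (simp add: left_diff_distrib)
  with \<phi> show False
    using scaleR_x_atom_le_iff[OF \<phi>(1), of r 0] order_trans by fastforce
qed

text \<open>Polynomials act on the idempotent \<open>y\<close> as reals, by
  \<open>peval_eigen\<close>. As \<open>d\<close> is a join of polynomials, the supremum
  \<open>r\<close> of their values is the candidate.\<close>

lemma value_exists:
  assumes \<phi>: "bal_hom \<phi>" shows "\<exists>r. d * x (atom \<phi>) = r *\<^sub>R x (atom \<phi>)"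
proof -
  define y where "y = x (atom \<phi>)"
  have y: "0 \<le> y" "y \<le> 1" "y * y = y" by (simp_all add: y_def x_nonneg x_le_1 x_idem)
  have le_iff: "r *\<^sub>R y \<le> s *\<^sub>R y \<longleftrightarrow> r \<le> s" for r s
    unfolding y_def by (rule scaleR_x_atom_le_iff[OF \<phi>])
  obtain S where S: "S \<subseteq> range (peval x)" "is_join S d" by (rule join_representation)
  obtain N where N: "d \<le> of_real N" by (rule of_real_bound)
  have upper: "w \<le> d" if "w \<in> S" for w using S(2) that by (simp add: is_join_def)
  have least: "d \<le> u" if "\<And>w. w \<in> S \<Longrightarrow> w \<le> u" for u using S(2) that by (simp add: is_join_def)
  define R where "R = {r. \<exists>w\<in>S. w * y = r *\<^sub>R y}"
  have val: "\<exists>r\<in>R. w * y = r *\<^sub>R y" if w: "w \<in> S" for w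
  proof -
    obtain p where p: "w = peval x p" using w S(1) by blast
    have "w * y = peval (pt_val \<phi>) p *\<^sub>R y"
      unfolding p y_def by (rule peval_eigen) (rule x_mult_atom[OF \<phi>])
    then show ?thesis using w unfolding R_def by blast
  qed
  have Rd: "r *\<^sub>R y \<le> d * y" if r: "r \<in> R" for r
    using r upper mult_right_mono[OF _ y(1)] unfolding R_def by fastforce
  have dN: "d * y \<le> N *\<^sub>R y"
    using mult_right_mono[OF N y(1)] by (simp add: scaleR_conv_of_real)
  have "r \<le> N" if "r \<in> R" for r
    using order_trans[OF Rd[OF that] dN] le_iff by blast
  then have bdd: "bdd_above R" by (auto simp: bdd_above_def)
  have "S \<noteq> {}"
  proof
    assume "S = {}"
    \<comment> \<open>Everything bounds the empty set from above, including
      \<open>d - 1\<close>.\<close>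
    then have "d \<le> d - 1" by (intro least) simp
    then have "(1::'d) \<le> 0" by (simp add: le_diff_eq)
    then show False using zero_le_one_bal[where 'a='d] zero_neq_one antisym by blast
  qed
  then have "R \<noteq> {}" using val by blast
  define r where "r = Sup R"
  have "r *\<^sub>R y \<le> d * y"
  proof (rule le_epsilon_bal)
    fix \<epsilon> :: real assume \<epsilon>: "0 < \<epsilon>"
    obtain s where s: "s \<in> R" "r - \<epsilon> < s"
      using less_cSup_iff[OF \<open>R \<noteq> {}\<close> bdd, of "r - \<epsilon>"] \<epsilon> unfolding r_def by auto
    have "r *\<^sub>R y \<le> (s + \<epsilon>) *\<^sub>R y" using s by (intro scaleR_right_mono y) simp
    also have "\<dots> = s *\<^sub>R y + \<epsilon> *\<^sub>R y" by (simp add: scaleR_add_left)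
    also have "\<dots> \<le> d * y + of_real \<epsilon>"
      unfolding of_real_def using \<epsilon> by (intro add_mono Rd s scaleR_left_mono y) simp
    finally show "r *\<^sub>R y \<le> d * y + of_real \<epsilon>" .
  qed
  moreover have "d * y \<le> r *\<^sub>R y"
  proof -
    \<comment> \<open>This bound is \<open>r\<close> at the atom and the constant \<open>N\<close>
      away from it; multiplication by \<open>y\<close> then removes the second term.\<close>
    have "d \<le> r *\<^sub>R y + of_real N * (1 - y)"
    proof (rule least)
      fix w assume w: "w \<in> S"
      obtain s where s: "s \<in> R" "w * y = s *\<^sub>R y" using val[OF w] by blast
      have "w * y \<le> r *\<^sub>R y"
        unfolding s(2) le_iff r_def by (rule cSup_upper[OF s(1) bdd])
      moreover have "w * (1 - y) \<le> of_real N * (1 - y)"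
        using upper[OF w] N y(2) by (intro mult_right_mono) (auto intro: order_trans)
      ultimately have "w * y + w * (1 - y) \<le> r *\<^sub>R y + of_real N * (1 - y)" by (rule add_mono)
      then show "w \<le> r *\<^sub>R y + of_real N * (1 - y)" by (simp add: right_diff_distrib)
    qed
    from mult_right_mono[OF this y(1)] show ?thesis
      by (simp add: distrib_right mult.assoc left_diff_distrib y(3))
  qed
  ultimately show ?thesis unfolding y_def by (intro exI[of _ r] antisym)
qed

section \<open>Evaluations of the completion at the points\<close>

definition ev :: "('a \<Rightarrow> real) \<Rightarrow> 'd \<Rightarrow> real" where
  "ev \<phi> d = (THE r. d * x (atom \<phi>) = r *\<^sub>R x (atom \<phi>))"

lemma ev_eqI:
  assumes "bal_hom \<phi>" "d * x (atom \<phi>) = r *\<^sub>R x (atom \<phi>)" shows "ev \<phi> d = r"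
  unfolding ev_def using assms x_atom_nonzero by (intro the_equality) auto

lemma ev_eq: "bal_hom \<phi> \<Longrightarrow> d * x (atom \<phi>) = ev \<phi> d *\<^sub>R x (atom \<phi>)"
  using value_exists[of \<phi> d] ev_eqI by blast

lemma bal_hom_ev:
  assumes "bal_hom \<phi>" shows "bal_hom (ev \<phi>)"
proof (rule positive_hom_bal_hom)
  note eq = ev_eq[OF assms]
  fix a b :: 'd and r :: real
  show "ev \<phi> (a + b) = ev \<phi> a + ev \<phi> b"
    by (rule ev_eqI[OF assms]) (simp only: distrib_right eq[of a] eq[of b] scaleR_add_left)
  show "ev \<phi> (a * b) = ev \<phi> a * ev \<phi> b"
    by (rule ev_eqI[OF assms]) (simp add: mult.assoc eq[of a] eq[of b] mult.commute[of "ev \<phi> b"])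
  show "ev \<phi> (r *\<^sub>R a) = r * ev \<phi> a"
    by (rule ev_eqI[OF assms]) (simp add: eq[of a])
  show "ev \<phi> 1 = 1"
    by (rule ev_eqI[OF assms]) simp
  show "0 \<le> ev \<phi> a" if "0 \<le> a"
    using mult_nonneg_nonneg[OF that x_nonneg[of "atom \<phi>"]] scaleR_x_atom_le_iff[OF assms, of 0 "ev \<phi> a"]
    by (simp add: eq[of a])
qed

lemma ev_reflects_le: "(\<And>\<phi>. bal_hom \<phi> \<Longrightarrow> ev \<phi> d \<le> ev \<phi> d') \<Longrightarrow> d \<le> d'"
  by (rule atoms_reflect_le) (simp add: ev_eq scaleR_x_atom_le_iff)

lemma ev_reflects_eq: "(\<And>\<phi>. bal_hom \<phi> \<Longrightarrow> ev \<phi> d = ev \<phi> d') \<Longrightarrow> d = d'"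
  by (intro antisym ev_reflects_le) simp_all

lemma ev_x: "bal_hom \<phi> \<Longrightarrow> ev \<phi> (x e) = of_bool (atom \<phi> \<le> e)"
  by (rule ev_eqI) (auto simp: x_mult_atom pt_val_def)

lemma ev_x_atom:
  assumes "bal_hom \<phi>" "bal_hom \<psi>" shows "ev \<psi> (x (atom \<phi>)) = of_bool (\<psi> = \<phi>)"
  using atom_disjoint[OF assms(2,1)] atom_nonbot[OF assms(2)]
  by (auto simp: ev_x[OF assms(2)] inf_absorb1)

text \<open>As a function on the points, this is \<open>d\<close> with its value at \<phi> replaced
  by \<open>c\<close>.\<close>

definition override :: "('a \<Rightarrow> real) \<Rightarrow> real \<Rightarrow> 'd \<Rightarrow> 'd" where
  "override \<phi> c d = d * (1 - x (atom \<phi>)) + c *\<^sub>R x (atom \<phi>)"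

lemma ev_override:
  assumes "bal_hom \<phi>" "bal_hom \<psi>"
  shows "ev \<psi> (override \<phi> c d) = (if \<psi> = \<phi> then c else ev \<psi> d)"
  using bal_hom_ev[OF assms(2)] unfolding override_def
  by (simp add: bal_hom_add bal_hom_mult bal_hom_diff bal_hom_one bal_hom_scaleR ev_x_atom[OF assms])

lemma ev_mono: "bal_hom \<phi> \<Longrightarrow> d \<le> d' \<Longrightarrow> ev \<phi> d \<le> ev \<phi> d'"
  by (rule bal_hom_mono[OF bal_hom_ev])

text \<open>Replacing the value of \<open>m\<close> at \<phi> by \<open>c\<close> yields another
  lower bound of \<open>S\<close>, which is therefore below \<open>m\<close>; compare the values at
  \<phi>. This is how evaluations control infinite meets.\<close>

lemma ev_is_meet_ge:
  assumes "bal_hom \<phi>" "is_meet S m" "\<And>s. s \<in> S \<Longrightarrow> c \<le> ev \<phi> s"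
  shows "c \<le> ev \<phi> m"
proof -
  have "override \<phi> c m \<le> s" if "s \<in> S" for s
    using assms that by (intro ev_reflects_le) (auto simp: ev_override is_meet_def intro: ev_mono)
  then have "override \<phi> c m \<le> m" using assms(2) by (simp add: is_meet_def)
  from ev_mono[OF assms(1) this] show ?thesis by (simp add: ev_override assms(1))
qed

lemma ev_is_join_le:
  assumes "bal_hom \<phi>" "is_join S m" "\<And>s. s \<in> S \<Longrightarrow> ev \<phi> s \<le> c"
  shows "ev \<phi> m \<le> c"
proof -
  have "s \<le> override \<phi> c m" if "s \<in> S" for s
    using assms that by (intro ev_reflects_le) (auto simp: ev_override is_join_def intro: ev_mono)
  then have "m \<le> override \<phi> c m" using assms(2) by (simp add: is_join_def)
  from ev_mono[OF assms(1) this] show ?thesis by (simp add: ev_override assms(1))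
qed

section \<open>The map \<open>alpha\<close> seen through the evaluations\<close>

lemma ev_alpha:
  assumes \<phi>: "bal_hom \<phi>" shows "ev \<phi> (alpha j x a) = \<phi> a"
proof -
  define s where "s = (SOME s::real. 0 \<le> a + of_real s)"
  define c where "c = a + of_real s"
  define T where "T = {r *\<^sub>R x (- j I) | r I. I \<in> Arch \<and> negpart (c - of_real r) \<in> I}"
  have "0 \<le> c"
    unfolding c_def s_def
  proof (rule someI_ex)
    obtain N where "- of_real N \<le> a" by (rule of_real_bound)
    then show "\<exists>s. 0 \<le> a + of_real s"
      using add_right_mono[of "- of_real N" a "of_real N"] by (intro exI[of _ N]) simp
  qed
  have T_le: "ev \<psi> t \<le> \<psi> c" if \<psi>: "bal_hom \<psi>" and "t \<in> T" for \<psi> t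
  proof -
    obtain r I where t: "t = r *\<^sub>R x (- j I)" and I: "I \<in> Arch" "negpart (c - of_real r) \<in> I"
      using \<open>t \<in> T\<close> unfolding T_def by blast
    have ev_t: "ev \<psi> t = r * of_bool (atom \<psi> \<le> - j I)"
      unfolding t by (simp add: bal_hom_scaleR[OF bal_hom_ev[OF \<psi>]] ev_x[OF \<psi>])
    show ?thesis
    proof (cases "atom \<psi> \<le> - j I")
      case True
      \<comment> \<open>Otherwise the atom would also lie below \<open>j I\<close>. So \<psi> kills
        \<open>I\<close>, and the membership condition reads
        \<open>r \<le> \<psi> c\<close>.\<close>
      then have "I \<subseteq> pt_ker \<psi>"
        using atom_le[OF \<psi> I(1)] not_atom_le_both[OF \<psi>] by blast
      then have "\<psi> (negpart (c - of_real r)) = 0" using I(2) by (auto simp: pt_ker_def)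
      then have "negpart (\<psi> c - r) = 0"
        by (simp add: bal_hom_negpart[OF \<psi>] bal_hom_diff[OF \<psi>] bal_hom_of_real[OF \<psi>])
      then show ?thesis using True by (simp add: ev_t negpart_eq_0_iff)
    next
      case False
      \<comment> \<open>The term has value 0 here; this stays below \<open>\<psi> c\<close> thanks
        to the shift by \<open>s\<close>.\<close>
      then show ?thesis using bal_hom_mono[OF \<psi> \<open>0 \<le> c\<close>] by (simp add: ev_t bal_hom_zero[OF \<psi>])
    qed
  qed
  \<comment> \<open>In a conditionally complete lattice \<open>Sup T\<close> is known to be the join
    only once \<open>T\<close> is nonempty and bounded.\<close>
  obtain N where N: "c \<le> of_real N" by (rule of_real_bound)
  have "t \<le> of_real N" if "t \<in> T" for t
  proof (rule ev_reflects_le)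
    fix \<psi> :: "'a \<Rightarrow> real" assume \<psi>: "bal_hom \<psi>"
    show "ev \<psi> t \<le> ev \<psi> (of_real N)"
      using order_trans[OF T_le[OF \<psi> that] bal_hom_mono[OF \<psi> N]]
      by (simp add: bal_hom_of_real[OF \<psi>] bal_hom_of_real[OF bal_hom_ev[OF \<psi>]])
  qed
  then have bdd: "bdd_above T" by (auto simp: bdd_above_def)
  \<comment> \<open>This member of \<open>T\<close>, concentrated at \<phi>, attains the upper bound
    there.\<close>
  have mem: "\<phi> c *\<^sub>R x (atom \<phi>) \<in> T"
    unfolding T_def atom_def using pt_ker_Arch[OF \<phi>]
    by (intro CollectI exI[of _ "\<phi> c"] exI[of _ "pt_ker \<phi>"] conjI)
      (auto simp: pt_ker_def bal_hom_negpart[OF \<phi>] bal_hom_diff[OF \<phi>] bal_hom_of_real[OF \<phi>] negpart_eq_0_iff)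
  then have "is_join T (Sup T)"
    unfolding is_join_def by (metis bdd cSup_upper cSup_least empty_iff)
  then have "ev \<phi> (Sup T) \<le> \<phi> c" using T_le[OF \<phi>] by (rule ev_is_join_le[OF \<phi>])
  moreover have "\<phi> c \<le> ev \<phi> (Sup T)"
    using ev_mono[OF \<phi> cSup_upper[OF mem bdd]]
    by (simp add: bal_hom_scaleR[OF bal_hom_ev[OF \<phi>]] ev_x_atom[OF \<phi> \<phi>])
  ultimately have "ev \<phi> (Sup T) = \<phi> c" by (rule antisym)
  moreover have "alpha j x a = - of_real s + Sup T"
    unfolding alpha_def Let_def T_def c_def s_def ..
  ultimately show ?thesis
    using bal_hom_ev[OF \<phi>] \<phi>
    by (simp add: bal_hom_add bal_hom_uminus bal_hom_of_real bal_hom_diff c_def)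
qed

lemma bal_hom_alpha: "bal_hom (alpha j x)"
  unfolding bal_hom_def
  by (intro conjI allI; rule ev_reflects_eq)
    (simp_all add: ev_alpha bal_hom_ev bal_hom_add bal_hom_mult bal_hom_scaleR bal_hom_one
      bal_hom_sup bal_hom_inf)

lemma inj_alpha: "inj (alpha j x)"
proof (rule injI)
  fix a b assume "alpha j x a = alpha j x b"
  then have "\<phi> a = \<phi> b" if "bal_hom \<phi>" for \<phi> :: "'a \<Rightarrow> real" using ev_alpha[OF that] by metis
  then show "a = b" by (metis points_reflect_le antisym order_refl)
qed

text \<open>The witnesses \<open>override \<phi> (ev \<phi> d) (- N)\<close> are the functions equal to \<open>d\<close> at \<open>\<phi>\<close> and to a lower
  bound of \<open>d\<close> elsewhere; such a function is an infimum of elements of \<open>A\<close> because an element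
  vanishing at \<open>\<phi>\<close> but not at \<open>\<psi>\<close> can be squared and scaled.\<close>

lemma dense_alpha: "dense_map (alpha j x)"
  unfolding dense_map_def
proof
  fix d :: 'd
  obtain N where N: "- of_real N \<le> d" by (rule of_real_bound)
  have evN: "ev \<phi> (- of_real N) = - N" if "bal_hom \<phi>" for \<phi>
    using bal_hom_ev[OF that] by (simp add: bal_hom_uminus bal_hom_of_real)
  have N_le: "- N \<le> ev \<phi> d" if "bal_hom \<phi>" for \<phi>
    using ev_mono[OF that N] evN[OF that] by simp
  define m where "m \<phi> = override \<phi> (ev \<phi> d) (- of_real N)" for \<phi>
  have ev_m: "ev \<psi> (m \<phi>) = (if \<psi> = \<phi> then ev \<phi> d else - N)" if "bal_hom \<phi>" "bal_hom \<psi>" for \<phi> \<psi>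
    by (simp add: m_def ev_override[OF that] evN[OF that(2)])
  let ?M = "m ` {\<phi>. bal_hom \<phi>}"
  have "is_join ?M d"
    unfolding is_join_def
  proof (intro conjI allI impI ballI)
    fix t assume "t \<in> ?M"
    then show "t \<le> d" by (auto intro!: ev_reflects_le simp: ev_m N_le)
  next
    fix u assume u: "\<forall>t\<in>?M. t \<le> u"
    show "d \<le> u"
    proof (rule ev_reflects_le)
      fix \<phi> :: "'a \<Rightarrow> real" assume \<phi>: "bal_hom \<phi>"
      then have "m \<phi> \<le> u" using u by blast
      from ev_mono[OF \<phi> this] show "ev \<phi> d \<le> ev \<phi> u" by (simp add: ev_m \<phi>)
    qed
  qed
  moreover have "\<exists>S \<subseteq> range (alpha j x). is_meet S (m \<phi>)" if \<phi>: "bal_hom \<phi>" for \<phi>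
  proof -
    \<comment> \<open>With every image above \<open>m \<phi>\<close> included, only the
      greatest-lower-bound property is left to check.\<close>
    let ?S = "{t \<in> range (alpha j x). m \<phi> \<le> t}"
    have "u \<le> m \<phi>" if u: "\<forall>t\<in>?S. u \<le> t" for u
    proof (rule ev_reflects_le)
      fix \<psi> :: "'a \<Rightarrow> real" assume \<psi>: "bal_hom \<psi>"
      have le: "ev \<psi> u \<le> \<psi> a" if a: "\<And>\<chi>. bal_hom \<chi> \<Longrightarrow> ev \<chi> (m \<phi>) \<le> \<chi> a" for a
      proof -
        have "m \<phi> \<le> alpha j x a" using a by (intro ev_reflects_le) (simp add: ev_alpha)
        then have "u \<le> alpha j x a" using u by blast
        from ev_mono[OF \<psi> this] show ?thesis by (simp add: ev_alpha \<psi>)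
      qed
      show "ev \<psi> u \<le> ev \<psi> (m \<phi>)"
      proof (cases "\<psi> = \<phi>")
        case True
        have "ev \<psi> u \<le> \<psi> (of_real (ev \<phi> d))"
          by (rule le) (auto simp: bal_hom_of_real ev_m \<phi> N_le)
        then show ?thesis using True by (simp add: ev_m \<phi> bal_hom_of_real)
      next
        case False
        then obtain b where b: "\<phi> b = 0" "\<psi> b \<noteq> 0"
          using pt_ker_eqD[OF \<phi> \<psi>] by (auto simp: pt_ker_def)
        \<comment> \<open>With this factor \<open>ev \<phi> d - k * (\<psi> b * \<psi> b)\<close> is
          exactly \<open>- N\<close>. At \<phi> the square vanishes and the value
          \<open>ev \<phi> d\<close> remains, while the \<open>sup\<close> in \<open>a\<close> keeps
          it at least \<open>- N\<close> at all other points.\<close>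
        define k where "k = (ev \<phi> d + N) / (\<psi> b * \<psi> b)"
        define a where "a = sup (of_real (ev \<phi> d) - k *\<^sub>R (b * b)) (- of_real N)"
        have chi: "\<chi> a = max (ev \<phi> d - k * (\<chi> b * \<chi> b)) (- N)" if "bal_hom \<chi>" for \<chi>
          using that by (simp add: a_def bal_hom_sup bal_hom_diff bal_hom_scaleR bal_hom_mult
              bal_hom_of_real bal_hom_uminus sup_real_def)
        have "ev \<psi> u \<le> \<psi> a"
          by (rule le) (auto simp: ev_m \<phi> chi b)
        also have "\<psi> a = - N" using b(2) by (simp add: chi \<psi> k_def)
        finally show ?thesis using False by (simp add: ev_m \<phi> \<psi>)
      qed
    qed
    then have "is_meet ?S (m \<phi>)" by (simp add: is_meet_def)
    then show ?thesis by (intro exI[of _ ?S]) auto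
  qed
  ultimately show "\<exists>M. is_join M d \<and> (\<forall>m\<in>M. \<exists>S \<subseteq> range (alpha j x). is_meet S m)"
    by (intro exI[of _ ?M]) auto
qed

text \<open>A point killing every \<open>pospart (t - s)\<close> would place its values on
  \<open>T\<close> below those on \<open>S\<close>, contradicting the gap \<epsilon> between meet
  and join. So finitely many of these positive parts generate 1, and the pairs behind them supply
  \<open>S0\<close> and \<open>T0\<close>.\<close>

lemma compact_alpha: "compact_map (alpha j x)"
  unfolding compact_map_def
proof (intro allI impI, elim conjE)
  fix S T :: "'a set" and \<epsilon> :: real and m k
  assume ST: "S \<noteq> {}" "T \<noteq> {}" and \<epsilon>: "\<epsilon> > 0" and m: "is_meet (alpha j x ` S) m"
    and k: "is_join (alpha j x ` T) k" and mk: "m + of_real \<epsilon> \<le> k"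
  define P where "P = (\<lambda>(s, t). pospart (t - s)) ` (S \<times> T)"
  have "\<exists>F (n::nat). finite F \<and> F \<subseteq> P \<and> 1 \<le> of_nat n * (\<Sum>p\<in>F. labs p)"
  proof (rule ccontr)
    assume none: "\<not> ?thesis"
    obtain \<phi> :: "'a \<Rightarrow> real" where \<phi>: "bal_hom \<phi>" "\<And>p. p \<in> P \<Longrightarrow> \<phi> p = 0"
    proof (rule point_vanishing_on[of P])
      show "\<not> 1 \<le> of_nat n * (\<Sum>p\<in>F. labs p)" if "finite F" "F \<subseteq> P" for F and n :: nat
        using none that by blast
    qed blast
    have ts: "\<phi> t \<le> \<phi> s" if "s \<in> S" "t \<in> T" for s t
    proof -
      have "\<phi> (pospart (t - s)) = 0" using \<phi>(2) that unfolding P_def by blast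
      then show ?thesis
        by (simp add: bal_hom_pospart[OF \<phi>(1)] bal_hom_diff[OF \<phi>(1)] pospart_eq_0_iff)
    qed
    \<comment> \<open>Any real lying above the values on \<open>T\<close> and below those on
      \<open>S\<close> would do.\<close>
    define c where "c = Sup (\<phi> ` T)"
    obtain s where "s \<in> S" using ST(1) by blast
    then have bdd: "bdd_above (\<phi> ` T)" using ts by (intro bdd_aboveI[of _ "\<phi> s"]) auto
    have "c \<le> ev \<phi> m"
    proof (rule ev_is_meet_ge[OF \<phi>(1) m])
      fix u assume "u \<in> alpha j x ` S"
      then show "c \<le> ev \<phi> u" unfolding c_def using ST(2) ts by (auto simp: ev_alpha \<phi>(1) intro!: cSup_least)
    qed
    moreover have "ev \<phi> k \<le> c"
    proof (rule ev_is_join_le[OF \<phi>(1) k])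
      fix u assume "u \<in> alpha j x ` T"
      then show "ev \<phi> u \<le> c" unfolding c_def using bdd by (auto simp: ev_alpha \<phi>(1) intro!: cSup_upper)
    qed
    moreover have "ev \<phi> m + \<epsilon> \<le> ev \<phi> k"
      using ev_mono[OF \<phi>(1) mk] bal_hom_ev[OF \<phi>(1)] by (simp add: bal_hom_add bal_hom_of_real)
    ultimately show False using \<epsilon> by simp
  qed
  then obtain F and n :: nat where F: "finite F" "F \<subseteq> P" "1 \<le> of_nat n * (\<Sum>p\<in>F. labs p)" by blast
  obtain W where W: "W \<subseteq> S \<times> T" "finite W" "F = (\<lambda>(s, t). pospart (t - s)) ` W"
    using finite_subset_image[OF F(1) F(2)[unfolded P_def]] by blast
  have "W \<noteq> {}"
  proof
    assume "W = {}"
    then have "(1::'a) \<le> 0" using F(3) W(3) by simp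
    then show False using zero_le_one_bal[where 'a='a] zero_neq_one antisym by blast
  qed
  let ?S0 = "fst ` W" and ?T0 = "snd ` W"
  have "Inf_fin ?S0 \<le> Sup_fin ?T0"
  proof (rule points_reflect_le)
    fix \<phi> :: "'a \<Rightarrow> real" assume \<phi>: "bal_hom \<phi>"
    \<comment> \<open>Otherwise \<phi> would kill \<open>F\<close> and hence send 1 below 0. The
      pair depends on \<phi>, but \<open>Inf_fin\<close> and \<open>Sup_fin\<close> are comparable
      with the components of every pair.\<close>
    have "\<exists>(s, t)\<in>W. \<phi> s < \<phi> t"
    proof (rule ccontr)
      assume neg: "\<not> ?thesis"
      have "\<phi> p = 0" if "p \<in> F" for p
      proof -
        obtain s t where "(s, t) \<in> W" "p = pospart (t - s)" using \<open>p \<in> F\<close> W(3) by auto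
        then show ?thesis
          using neg by (auto simp: bal_hom_pospart[OF \<phi>] bal_hom_diff[OF \<phi>] pospart_eq_0_iff not_less)
      qed
      then have "F \<subseteq> pt_ker \<phi>" by (auto simp: pt_ker_def)
      moreover have "l_ideal (pt_ker \<phi>)" using pt_ker_Arch[OF \<phi>] by (simp add: Arch_def arch_ideal_def)
      ultimately have "of_nat n * (\<Sum>p\<in>F. labs p) \<in> pt_ker \<phi>"
        by (intro l_ideal_mult l_ideal_sum l_ideal_labs) auto
      then show False
        using bal_hom_mono[OF \<phi> F(3)] bal_hom_one[OF \<phi>] by (simp add: pt_ker_def)
    qed
    then obtain s t where st: "(s, t) \<in> W" "\<phi> s < \<phi> t" by blast
    have "Inf_fin ?S0 \<le> s"
      using W(2) st(1) by (intro Inf_fin.coboundedI) force+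
    moreover have "t \<le> Sup_fin ?T0"
      using W(2) st(1) by (intro Sup_fin.coboundedI) force+
    ultimately show "\<phi> (Inf_fin ?S0) \<le> \<phi> (Sup_fin ?T0)"
      using st(2) bal_hom_mono[OF \<phi>] by (meson less_imp_le order_trans)
  qed
  then show "\<exists>S0 T0. finite S0 \<and> S0 \<noteq> {} \<and> S0 \<subseteq> S \<and> finite T0 \<and> T0 \<noteq> {} \<and> T0 \<subseteq> T \<and>
      Inf_fin S0 \<le> Sup_fin T0"
    using W \<open>W \<noteq> {}\<close> by (intro exI[of _ ?S0] exI[of _ ?T0]) auto
qed

end

theorem mainTheorem10:
  fixes j :: "'a::ba_algebra set \<Rightarrow> 'b::boolean_algebra"
    and x :: "'b \<Rightarrow> 'd::{ba_algebra, conditionally_complete_lattice}"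
  assumes "free_bool_ext j"
    and "dedekind_completion_RB x"
  shows "canonical_extension (alpha j x)"
proof -
  interpret arch_dedekind_completion j x
    using assms by unfold_locales
  show ?thesis
    unfolding canonical_extension_def
    using bal_hom_alpha inj_alpha dense_alpha compact_alpha by blast
qed

end
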